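(* Let $V\in\mathcal P^{s,p}_q(\mathbb R^n)$ and $g\in W^{s,p}(\mathbb R^n)$, where $q>\frac{n}{ps}>1$, $p>1$ and $0<s<1$. If $u\in\mathrm Y^{s,p}_g(\Omega)^+$ is a weak supersolution of the nonlocal equation $\mathrm L^p_K u+V|u|^{p-2}u=0$ in $\Omega$, $u=g$ in $\mathbb R^n\setminus\Omega$, with $u\ge0$ in $B_R(x_0)\subset\Omega$, then there is a constant $c_0>0$ depending only on $n,s,p,\lambda,\Lambda$ and $\Omega$ such that $$\iint_{B_r(x_0)\times B_r(x_0)}\left|\ln\left(\frac{u(x)+b}{u(y)+b}\right)\right|^p d_K(x,y)\le c_0\,r^{n-ps}\left[\frac1{b^{p-1}}\left(\frac rR\right)^{ps}[\mathcal T_R(u_-;x_0)]^{p-1}+\bigl(1+\|V_+\|_{L^q(\Omega)}\bigr)\right]$$ for any $b\in(0,1)$ and $r\in(0,R/2)$.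
   Context: Throughout, $\Omega\subset\mathbb R^n$ is a bounded domain with Lipschitz boundary, $f_+=\max\{f,0\}$, $f_-=\max\{-f,0\}$, and $B_r(x_0)$ is the ball of radius $r$ centered at $x_0$. Kernel and operator: $K$ is a positive kernel with $\frac{c_{n,p,s}\lambda}{|y|^{n+ps}}\le K(y)=K(-y)\le\frac{c_{n,p,s}\Lambda}{|y|^{n+ps}}$ for $y\in\mathbb R^n\setminus\{0\}$, where $0<\lambda\le\Lambda$ and $c_{n,p,s}=\frac{\Gamma(\frac{n+p}{2})\,p\,(1-s)}{\pi^{(n-1)/2}\Gamma(\frac{p+1}{2})}$. Set $H_p(t)=|t|^{p-2}t$, $d_K(x,y)=K(x-y)\,dx\,dy$, and $\mathrm L^p_Ku(x)=\mathrm{p.v.}\int_{\mathbb R^n}H_p(u(x)-u(y))K(x-y)\,dy$. Weights: a weight is a locally integrable function on $\mathbb R^n$ with values in $[0,\infty)$ a.e. A pair of weights $(\upsilon,\omega)$ is in the $(A_1,A_1)$-Muckenhoupt class if $\sup_Q\left(\frac1{|Q|}\int_Q\upsilon\,dy\right)\|\omega^{-1}\|_{L^\infty(Q)}<\infty$ (supremum over all cubes $Q\subset\mathbb R^n$), and $\omega\in A_1$ if $(\omega,\omega)\in(A_1,A_1)$. Potentials: for $q>\frac n{ps}>1$, $\mathcal P^{s,p}_q(\mathbb R^n)$ is the class of all potentials $V=V_+-V_-$ such that (i) $V_-\in L^1_{\rm loc}(\mathbb R^n)$; (ii) $V_+\in L^q_{\rm loc}(\mathbb R^n)$; (iii) there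 is an a.e. positive bounded function $b$ on $\mathbb R^n$ such that $V_+/b\in L^q_{\rm loc}(\mathbb R^n)$ and, for all $i\in\mathbb N$, with $V_+^{b,i}:=\frac{\max\{b,1/i\}}{b}V_+$, one has $(V_-,V_+^{b,i})\in(A_1,A_1)$ and $V_+^{b,i}\in A_1$. (This function $b$ is unrelated to the number $b\in(0,1)$ in the claim.) Function spaces: $\mathrm X^{s,p}(\Omega)$ is the space of measurable $v:\mathbb R^n\to\mathbb R$ with $v|_\Omega\in L^p(\Omega)$ and $\iint_{\mathbb R^{2n}\setminus(\Omega^c\times\Omega^c)}\frac{|v(x)-v(y)|^p}{|x-y|^{n+ps}}dx\,dy<\infty$; $\mathrm X^{s,p}_0(\Omega)=\{v\in\mathrm X^{s,p}(\Omega):v=0\text{ a.e. in }\mathbb R^n\setminus\Omega\}$. $L^p_V(\Omega)$ is the class of measurable $u:\mathbb R^n\to\mathbb R$ with $\int_\Omega|u|^pV_+\,dy<\infty$ and $\int_\Omega|u|^pV_-\,dy<\infty$. $\mathrm Y^{s,p}(\Omega)=\mathrm X^{s,p}(\Omega)\cap L^p_V(\Omega)$, $\mathrm Y^{s,p}_0(\Omega)=\mathrm X^{s,p}_0(\Omega)\cap L^p_V(\Omega)$, $\mathrm Y^{s,p}_g(\Omega)^\pm=\{u\in\mathrm Y^{s,p}(\Omega):(g-u)_\pm\in\mathrm Y^{s,p}_0(\Omega)\}$. $W^{s,p}(\mathbb R^n)$ is the usual fractional Sobolev space. Weak supersolution: $u\in\mathrm Y^{s,p}_g(\Omega)^+$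 is a weak supersolution if $$\iint_{\mathbb R^n\times\mathbb R^n}H_p(u(x)-u(y))(\varphi(x)-\varphi(y))\,d_K(x,y)+\int_{\mathbb R^n}V|u|^{p-2}u\,\varphi\,dx\ge0$$ for all nonnegative $\varphi\in\mathrm Y^{s,p}_0(\Omega)$. Nonlocal tail: for $B_r(x_0)\subset\Omega$, $\mathcal T_r(u;x_0)=\left(\frac{ps}{|S^{n-1}|}r^{ps}\int_{\mathbb R^n\setminus B_r(x_0)}\frac{|u(y)|^{p-1}}{|y-x_0|^{n+ps}}dy\right)^{\frac1{p-1}}$, where $|S^{n-1}|$ is the surface measure of the unit sphere. *)

theory Defs
  imports "HOL-Analysis.Analysis" "HOL-Probability.Essential_Supremum"
begin

text \<open>
  Measurability of functions on the Euclidean space is Lebesgue measurability, and integrals over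
  the product space are taken with respect to Lebesgue measure on the product type. Integrals of
  nonnegative functions are valued in \<open>[0,\<infinity>]\<close>, so that \<open>< \<infinity>\<close> really
  expresses finiteness.
\<close>

definition pos_part :: "('a \<Rightarrow> real) \<Rightarrow> 'a \<Rightarrow> real" where
  "pos_part f x = max (f x) 0"

definition neg_part :: "('a \<Rightarrow> real) \<Rightarrow> 'a \<Rightarrow> real" where
  "neg_part f x = max (- f x) 0"

text \<open>Extension of \<open>powr\<close> to \<open>[0,\<infinity>]\<close>, used for positive exponents only.\<close>

definition epowr :: "ennreal \<Rightarrow> real \<Rightarrow> ennreal" where
  "epowr x a = (if x = \<infinity> then \<infinity> else ennreal (enn2real x powr a))"

definition Lq_norm :: "real \<Rightarrow> (real^'n) set \<Rightarrow> (real^'n \<Rightarrow> real) \<Rightarrow> ennreal" where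
  "Lq_norm q \<Omega> f = epowr (\<integral>\<^sup>+x\<in>\<Omega>. ennreal (\<bar>f x\<bar> powr q) \<partial>lebesgue) (1 / q)"

definition Lq_loc :: "real \<Rightarrow> (real^'n \<Rightarrow> real) set" where
  "Lq_loc q = {f. f \<in> borel_measurable lebesgue \<and>
     (\<forall>C. compact C \<longrightarrow> (\<integral>\<^sup>+x\<in>C. ennreal (\<bar>f x\<bar> powr q) \<partial>lebesgue) < \<infinity>)}"


subsection \<open>Lipschitz domains\<close>

text \<open>
  Near each boundary point, and after a choice of the vertical direction \<open>e\<close>, the set is
  the strict epigraph of a Lipschitz function on the hyperplane orthogonal to \<open>e\<close>.
\<close>

definition lipschitz_boundary :: "(real^'n) set \<Rightarrow> bool" where
  "lipschitz_boundary \<Omega> \<longleftrightarrow>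
     (\<forall>z\<in>frontier \<Omega>. \<exists>U e \<gamma> L. open U \<and> z \<in> U \<and> norm e = 1 \<and>
        L-lipschitz_on {y. y \<bullet> e = 0} (\<gamma> :: real^'n \<Rightarrow> real) \<and>
        \<Omega> \<inter> U = {x\<in>U. \<gamma> (x - (x \<bullet> e) *\<^sub>R e) < x \<bullet> e})"

definition bounded_lipschitz_domain :: "(real^'n) set \<Rightarrow> bool" where
  "bounded_lipschitz_domain \<Omega> \<longleftrightarrow>
     open \<Omega> \<and> connected \<Omega> \<and> \<Omega> \<noteq> {} \<and> bounded \<Omega> \<and> lipschitz_boundary \<Omega>"


subsection \<open>Kernels\<close>

definition kernel_const :: "nat \<Rightarrow> real \<Rightarrow> real \<Rightarrow> real" where
  "kernel_const n p s =
     Gamma ((real n + p) / 2) * p * (1 - s) / (pi powr ((real n - 1) / 2) * Gamma ((p + 1) / 2))"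

definition is_kernel :: "real \<Rightarrow> real \<Rightarrow> real \<Rightarrow> real \<Rightarrow> (real^'n \<Rightarrow> real) \<Rightarrow> bool" where
  "is_kernel s p lam Lam K \<longleftrightarrow>
     K \<in> borel_measurable lebesgue \<and>
     (\<forall>y. y \<noteq> 0 \<longrightarrow>
        0 < K y \<and> K y = K (- y) \<and>
        kernel_const CARD('n) p s * lam / norm y powr (real CARD('n) + p * s) \<le> K y \<and>
        K y \<le> kernel_const CARD('n) p s * Lam / norm y powr (real CARD('n) + p * s))"

definition kernel_measure :: "(real^'n \<Rightarrow> real) \<Rightarrow> ((real^'n) \<times> (real^'n)) measure" where
  "kernel_measure K = density lebesgue (\<lambda>(x, y). ennreal (K (x - y)))"

definition H :: "real \<Rightarrow> real \<Rightarrow> real" where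
  "H p t = \<bar>t\<bar> powr (p - 2) * t"


subsection \<open>Muckenhoupt pairs and potentials\<close>

definition is_weight :: "(real^'n \<Rightarrow> real) \<Rightarrow> bool" where
  "is_weight w \<longleftrightarrow> w \<in> Lq_loc 1 \<and> (AE x in lebesgue. 0 \<le> w x)"

definition cubes :: "(real^'n) set set" where
  "cubes = {cbox a (a + (\<chi> i. l)) | a l. 0 < l}"

text \<open>
  The reciprocal is taken in \<open>[0,\<infinity>]\<close>, so it is \<open>\<infinity>\<close> where the weight vanishes; the
  product of the two factors follows the convention \<open>0 \<cdot> \<infinity> = 0\<close>.
\<close>

definition A1_pair :: "(real^'n \<Rightarrow> real) \<Rightarrow> (real^'n \<Rightarrow> real) \<Rightarrow> bool" where
  "A1_pair v w \<longleftrightarrow> is_weight v \<and> is_weight w \<and>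
     (SUP Q\<in>cubes. ((\<integral>\<^sup>+y\<in>Q. ennreal (v y) \<partial>lebesgue) / emeasure lebesgue Q) *
        esssup (restrict_space lebesgue Q) (\<lambda>y. inverse (ennreal (w y)))) < \<infinity>"

definition A1 :: "(real^'n \<Rightarrow> real) \<Rightarrow> bool" where
  "A1 w \<longleftrightarrow> A1_pair w w"

definition reg_pos_part ::
  "(real^'n \<Rightarrow> real) \<Rightarrow> (real^'n \<Rightarrow> real) \<Rightarrow> nat \<Rightarrow> real^'n \<Rightarrow> real" where
  "reg_pos_part V b i x = max (b x) (1 / real i) / b x * pos_part V x"

text \<open>The class depends on \<open>s\<close> and \<open>p\<close> only through the admissible range of \<open>q\<close>.\<close>

definition potentials :: "real \<Rightarrow> real \<Rightarrow> real \<Rightarrow> (real^'n \<Rightarrow> real) set" where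
  "potentials s p q = {V.
     q > real CARD('n) / (p * s) \<and> real CARD('n) / (p * s) > 1 \<and>
     neg_part V \<in> Lq_loc 1 \<and> pos_part V \<in> Lq_loc q \<and>
     (\<exists>b. b \<in> borel_measurable lebesgue \<and> (AE x in lebesgue. 0 < b x) \<and> bounded (range b) \<and>
        (\<lambda>x. pos_part V x / b x) \<in> Lq_loc q \<and>
        (\<forall>i\<ge>1. A1_pair (neg_part V) (reg_pos_part V b i) \<and> A1 (reg_pos_part V b i)))}"


subsection \<open>Function spaces\<close>

definition gagliardo ::
  "real \<Rightarrow> real \<Rightarrow> ((real^'n) \<times> (real^'n)) set \<Rightarrow> (real^'n \<Rightarrow> real) \<Rightarrow> ennreal" where
  "gagliardo s p A v =
     (\<integral>\<^sup>+z\<in>A. ennreal (\<bar>v (fst z) - v (snd z)\<bar> powr p /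
        norm (fst z - snd z) powr (real CARD('n) + p * s)) \<partial>lebesgue)"

definition W_sp :: "real \<Rightarrow> real \<Rightarrow> (real^'n \<Rightarrow> real) set" where
  "W_sp s p = {v. v \<in> borel_measurable lebesgue \<and>
     (\<integral>\<^sup>+x. ennreal (\<bar>v x\<bar> powr p) \<partial>lebesgue) < \<infinity> \<and> gagliardo s p UNIV v < \<infinity>}"

definition X_sp :: "real \<Rightarrow> real \<Rightarrow> (real^'n) set \<Rightarrow> (real^'n \<Rightarrow> real) set" where
  "X_sp s p \<Omega> = {v. v \<in> borel_measurable lebesgue \<and>
     (\<integral>\<^sup>+x\<in>\<Omega>. ennreal (\<bar>v x\<bar> powr p) \<partial>lebesgue) < \<infinity> \<and>
     gagliardo s p (UNIV - (- \<Omega>) \<times> (- \<Omega>)) v < \<infinity>}"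

definition X0_sp :: "real \<Rightarrow> real \<Rightarrow> (real^'n) set \<Rightarrow> (real^'n \<Rightarrow> real) set" where
  "X0_sp s p \<Omega> = {v \<in> X_sp s p \<Omega>. AE x in lebesgue. x \<notin> \<Omega> \<longrightarrow> v x = 0}"

definition L_V :: "real \<Rightarrow> (real^'n \<Rightarrow> real) \<Rightarrow> (real^'n) set \<Rightarrow> (real^'n \<Rightarrow> real) set" where
  "L_V p V \<Omega> = {u. u \<in> borel_measurable lebesgue \<and>
     (\<integral>\<^sup>+x\<in>\<Omega>. ennreal (\<bar>u x\<bar> powr p * pos_part V x) \<partial>lebesgue) < \<infinity> \<and>
     (\<integral>\<^sup>+x\<in>\<Omega>. ennreal (\<bar>u x\<bar> powr p * neg_part V x) \<partial>lebesgue) < \<infinity>}"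

definition Y_sp ::
  "real \<Rightarrow> real \<Rightarrow> (real^'n \<Rightarrow> real) \<Rightarrow> (real^'n) set \<Rightarrow> (real^'n \<Rightarrow> real) set" where
  "Y_sp s p V \<Omega> = X_sp s p \<Omega> \<inter> L_V p V \<Omega>"

definition Y0_sp ::
  "real \<Rightarrow> real \<Rightarrow> (real^'n \<Rightarrow> real) \<Rightarrow> (real^'n) set \<Rightarrow> (real^'n \<Rightarrow> real) set" where
  "Y0_sp s p V \<Omega> = X0_sp s p \<Omega> \<inter> L_V p V \<Omega>"

definition Yg_plus ::
  "real \<Rightarrow> real \<Rightarrow> (real^'n \<Rightarrow> real) \<Rightarrow> (real^'n) set \<Rightarrow> (real^'n \<Rightarrow> real) \<Rightarrow>
     (real^'n \<Rightarrow> real) set" where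
  "Yg_plus s p V \<Omega> g = {u \<in> Y_sp s p V \<Omega>. pos_part (\<lambda>x. g x - u x) \<in> Y0_sp s p V \<Omega>}"


subsection \<open>Weak supersolutions and the nonlocal tail\<close>

text \<open>
  For \<open>u\<close> and \<open>\<phi>\<close> in the spaces below, both integrands are integrable by the Hoelder inequality
  (\<open>\<phi>\<close> vanishes almost everywhere outside \<open>\<Omega>\<close>), so the Bochner integrals never take the default
  value of a non-integrable function.
\<close>

definition weak_supersolution ::
  "real \<Rightarrow> real \<Rightarrow> (real^'n \<Rightarrow> real) \<Rightarrow> (real^'n \<Rightarrow> real) \<Rightarrow> (real^'n) set \<Rightarrow> (real^'n \<Rightarrow> real) \<Rightarrow>
     (real^'n \<Rightarrow> real) \<Rightarrow> bool" where
  "weak_supersolution s p K V \<Omega> g u \<longleftrightarrow> u \<in> Yg_plus s p V \<Omega> g \<and>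
     (\<forall>\<phi>\<in>Y0_sp s p V \<Omega>. (\<forall>x. 0 \<le> \<phi> x) \<longrightarrow>
        (\<integral>z. H p (u (fst z) - u (snd z)) * (\<phi> (fst z) - \<phi> (snd z)) \<partial>kernel_measure K) +
        (\<integral>x. V x * \<bar>u x\<bar> powr (p - 2) * u x * \<phi> x \<partial>lebesgue) \<ge> 0)"

text \<open>
  Surface measure on the unit sphere of a set \<open>E\<close>, via the volume of the cone over \<open>E\<close>
  (normalised so that polar coordinates hold with \<open>r\<^sup>n\<^sup>-\<^sup>1\<close>).
\<close>

definition surface_measure :: "(real^'n) set \<Rightarrow> real" where
  "surface_measure E =
     real CARD('n) * measure lebesgue {t *\<^sub>R \<theta> | t \<theta>. 0 < t \<and> t \<le> 1 \<and> \<theta> \<in> E}"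

definition tail ::
  "real \<Rightarrow> real \<Rightarrow> real \<Rightarrow> (real^'n \<Rightarrow> real) \<Rightarrow> real^'n \<Rightarrow> ennreal" where
  "tail s p r u x0 =
     epowr (ennreal (p * s / surface_measure (sphere (0 :: real^'n) 1) * r powr (p * s)) *
       (\<integral>\<^sup>+y\<in>- ball x0 r. ennreal (\<bar>u y\<bar> powr (p - 1) /
          norm (y - x0) powr (real CARD('n) + p * s)) \<partial>lebesgue)) (1 / (p - 1))"

end

theory Submission
  imports Defs
begin

text \<open>
  The supersolution inequality is tested with \<open>\<phi> = \<eta>\<^sup>p (u\<^sub>+ + b)\<^bsup>1-p\<^esup>\<close>, where \<open>\<eta>\<close> is a cutoff equal
  to \<open>1\<close> on the ball of radius \<open>r\<close> and supported in the ball of radius \<open>3r/2\<close>. For two points of the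
  ball of radius \<open>R\<close> an elementary inequality bounds the nonlocal integrand by minus a multiple of
  \<open>\<bar>ln ((u x + b) / (u y + b))\<bar>\<^sup>p\<close> plus a multiple of \<open>\<bar>\<eta> x - \<eta> y\<bar>\<^sup>p\<close>. If one point lies outside that
  ball, the integrand is controlled by a constant and by the negative part of \<open>u\<close>, which produces the
  tail. Since \<open>u\<^bsup>p-1\<^esup> \<phi> \<le> 1\<close>, the potential term is at most the integral of \<open>V\<^sub>+\<close> over the support
  of \<open>\<eta>\<close>.
\<close>

section \<open>The logarithmic test inequality\<close>

text \<open>The sign condition on \<open>u\<close> holds almost everywhere in one ball only. Since
  \<open>max (u x) 0 + b\<close> is at least \<open>b\<close> at every point, the test function is
  still bounded and depends on \<open>u\<close> in a Lipschitz way. The Lipschitz constants blow up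
  as \<open>b\<close> tends to 0; they serve only to show that the test function is admissible and
  the energy integrand integrable. The final bound uses the pointwise inequality, whose right-hand
  side contains \<open>b\<close> only in front of the tail. The logarithmic integral is not known to
  be finite beforehand, so it is bounded without ever being subtracted. One constant has to serve
  all \<open>q\<close>, \<open>K\<close>, \<open>V\<close>, \<open>b\<close>, \<open>r\<close> and
  \<open>R\<close>, and scaling provides it. The cutoff term gives a ball volume, of order
  \<open>r powr n\<close>, times \<open>r powr (- (p * s))\<close>. The tail term gives
  \<open>r powr n\<close>, rewritten by means of \<open>(r / R) powr (p * s)\<close>. The potential
  gives \<open>r powr (n - n / q)\<close>, whose quotient by \<open>r powr (n - p * s)\<close> is a
  positive power of \<open>r\<close>, controlled by the diameter of \<Omega>.\<close>

lemma mult_exp_half_le: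
  fixes v :: real
  assumes "0 \<le> v"
  shows "v * exp (v / 2) \<le> exp v - 1"
proof -
  let ?g = "\<lambda>v::real. exp v - 1 - v * exp (v / 2)"
  have "?g 0 \<le> ?g v"
  proof (rule DERIV_nonneg_imp_nondecreasing[OF assms])
    fix x :: real
    assume "0 \<le> x" "x \<le> v"
    have "(?g has_real_derivative exp (x/2) * (exp (x/2) - 1 - x/2)) (at x)"
      by (auto intro!: derivative_eq_intros simp: algebra_simps simp flip: exp_add)
    moreover have "0 \<le> exp (x/2) * (exp (x/2) - 1 - x/2)"
      using exp_ge_add_one_self[of "x/2"] by (intro mult_nonneg_nonneg exp_ge_zero) linarith
    ultimately show "\<exists>y. (?g has_real_derivative y) (at x) \<and> 0 \<le> y" by blast
  qed
  then show ?thesis by simp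
qed

lemma Bernoulli_powr:
  fixes p w :: real
  assumes "1 \<le> p" "0 \<le> w"
  shows "1 + p * w \<le> (1 + w) powr p"
proof -
  let ?g = "\<lambda>w::real. (1 + w) powr p - 1 - p * w"
  have "?g 0 \<le> ?g w"
  proof (rule DERIV_nonneg_imp_nondecreasing[OF assms(2)])
    fix x :: real
    assume x: "0 \<le> x" "x \<le> w"
    have "(?g has_real_derivative p * ((1 + x) powr (p - 1) - 1)) (at x)"
      using x by (auto intro!: derivative_eq_intros simp: algebra_simps)
    moreover have "0 \<le> p * ((1 + x) powr (p - 1) - 1)"
      using x assms ge_one_powr_ge_zero[of "1 + x" "p - 1"] by simp
    ultimately show "\<exists>y. (?g has_real_derivative y) (at x) \<and> 0 \<le> y" by blast
  qed
  then show ?thesis by simp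
qed

text \<open>For \<open>t = exp (- v)\<close> and \<theta> the midpoint of \<open>t\<close> and 1,
  \<open>2 / (exp v + 1)\<close> is \<open>t / \<theta>\<close>; the right-hand side is the gain
  left after the convex splitting below. Its second factor is at least
  \<open>(p - 1) * v / (2 + p * v)\<close>, linear near 0 but bounded. The first is at least
  \<open>v powr (p - 1)\<close> times an exponential, because
  \<open>v / 2 \<le> sinh (v / 2)\<close>, and this exponential pays for the denominator
  \<open>2 + p * v\<close>. Small and large \<open>v\<close> thus need no separate
  treatment.\<close>

lemma log_profile_bound:
  fixes p v :: real
  assumes p: "1 < p" and v: "0 \<le> v"
  shows "(p - 1)\<^sup>2 / (2 * p) * v powr p
           \<le> (exp v - 1) powr (p - 1) * (1 - (2 / (exp v + 1)) powr (p - 1))"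
proof -
  define w where "w = v / 2"
  have w: "0 \<le> w" using v by (simp add: w_def)
  have "2 + 2 * w \<le> exp v + 1"
    using exp_ge_add_one_self[of v] unfolding w_def by linarith
  then have "2 / (exp v + 1) \<le> 2 / (2 + 2 * w)"
    using w by (intro divide_left_mono) (auto intro!: mult_pos_pos add_pos_nonneg)
  also have "\<dots> = 1 / (1 + w)" using w by (simp add: field_simps)
  finally have "2 / (exp v + 1) \<le> 1 / (1 + w)" .
  then have "(2 / (exp v + 1)) powr (p - 1) \<le> (1 / (1 + w)) powr (p - 1)"
    using p by (intro powr_mono2) (auto intro: add_nonneg_nonneg)
  \<comment> \<open>Bernoulli's inequality needs an exponent of at least 1, which
    \<open>p - 1\<close> may fail to be; hence the detour through the power
    \<open>p\<close>.\<close>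
  also have "\<dots> = (1 + w) / (1 + w) powr p"
    using w by (simp add: powr_diff powr_divide)
  also have "\<dots> \<le> (1 + w) / (1 + p * w)"
    using w p Bernoulli_powr[of p w]
    by (intro divide_left_mono) (auto intro!: mult_pos_pos add_pos_nonneg)
  finally have "1 - (1 + w) / (1 + p * w) \<le> 1 - (2 / (exp v + 1)) powr (p - 1)" by simp
  moreover have "1 - (1 + w) / (1 + p * w) = (p - 1) * v / (2 + p * v)"
  proof -
    have "2 + p * v > 0" "1 + p * w > 0" using p v w by (auto intro!: add_pos_nonneg)
    then show ?thesis unfolding w_def by (simp add: divide_simps) (simp add: algebra_simps)
  qed
  ultimately have 1: "(p - 1) * v / (2 + p * v) \<le> 1 - (2 / (exp v + 1)) powr (p - 1)" by simp
  have "1 + (p - 1) * v / 2 \<le> exp ((p - 1) * v / 2)" by (rule exp_ge_add_one_self)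
  moreover have "(p - 1) / (2 * p) * (2 + p * v) \<le> 1 + (p - 1) * v / 2"
    using p v by (simp add: field_simps)
  ultimately have 2: "(p - 1) / (2 * p) * (2 + p * v) \<le> exp ((p - 1) * v / 2)"
    by (rule order_trans[rotated])
  have "v powr (p - 1) * exp ((p - 1) * v / 2) = (v * exp (v / 2)) powr (p - 1)"
    using v by (simp add: powr_mult exp_powr_real mult.commute)
  also have "\<dots> \<le> (exp v - 1) powr (p - 1)"
    using p v mult_exp_half_le[OF v] by (intro powr_mono2) auto
  finally have 3: "v powr (p - 1) * exp ((p - 1) * v / 2) \<le> (exp v - 1) powr (p - 1)" .
  have pos: "2 + p * v > 0" using p v by (auto intro!: add_pos_nonneg)
  have "(p - 1)\<^sup>2 / (2 * p) * v powr p
      = (v powr (p - 1) * ((p - 1) / (2 * p) * (2 + p * v))) * ((p - 1) * v / (2 + p * v))"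
  proof (cases "v = 0")
    case False
    then have "v powr p = v powr (p - 1) * v" using v by (simp add: powr_diff)
    then show ?thesis using pos by (simp add: power2_eq_square)
  qed simp
  also have "\<dots> \<le> (v powr (p - 1) * exp ((p - 1) * v / 2)) * ((p - 1) * v / (2 + p * v))"
    using 2 p v pos by (intro mult_right_mono mult_left_mono) auto
  also have "\<dots> \<le> (exp v - 1) powr (p - 1) * (1 - (2 / (exp v + 1)) powr (p - 1))"
    using p v pos by (intro mult_mono 1 3) auto
  finally show ?thesis .
qed

text \<open>Convexity of the power, with \<alpha> written as the average of
  \<open>\<beta> / \<theta>\<close> and \<open>(\<alpha> - \<beta>) / (1 - \<theta>)\<close> with
  weights \<theta> and \<open>1 - \<theta>\<close>. Outside the range
  \<open>0 < \<beta> < \<alpha>\<close> a single term on the right suffices, both coefficients being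
  at least 1. A fixed \<theta> would not do: the later difference
  \<open>t powr (1 - p) - \<theta> powr (1 - p)\<close> would turn negative as \<open>t\<close>
  tends to 1.\<close>

lemma powr_convex_split:
  fixes \<alpha> \<beta> \<theta> p :: real
  assumes p: "1 < p" and "0 \<le> \<alpha>" "0 \<le> \<beta>" and th: "0 < \<theta>" "\<theta> < 1"
  shows "\<alpha> powr p \<le> \<theta> powr (1 - p) * \<beta> powr p + (1 - \<theta>) powr (1 - p) * \<bar>\<alpha> - \<beta>\<bar> powr p"
proof -
  have ge1: "1 \<le> \<theta> powr (1 - p)" "1 \<le> (1 - \<theta>) powr (1 - p)"
    using th p powr_mono2'[of "1 - p" \<theta> 1] powr_mono2'[of "1 - p" "1 - \<theta>" 1] by auto
  consider "\<alpha> \<le> \<beta>" | "\<beta> = 0" | "0 < \<beta>" "\<beta> < \<alpha>" using assms by linarith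
  then show ?thesis
  proof cases
    case 1
    have "\<alpha> powr p \<le> 1 * \<beta> powr p" using 1 assms by (simp add: powr_mono2)
    also have "\<dots> \<le> \<theta> powr (1 - p) * \<beta> powr p" by (intro mult_right_mono ge1) auto
    finally show ?thesis by (simp add: add_increasing2)
  next
    case 2
    have "1 * \<alpha> powr p \<le> (1 - \<theta>) powr (1 - p) * \<alpha> powr p" by (intro mult_right_mono ge1) auto
    then show ?thesis using 2 assms by simp
  next
    case 3
    let ?x = "\<beta> / \<theta>" and ?y = "(\<alpha> - \<beta>) / (1 - \<theta>)"
    have "((1 - (1 - \<theta>)) *\<^sub>R ?x + (1 - \<theta>) *\<^sub>R ?y) powr p
        \<le> (1 - (1 - \<theta>)) * ?x powr p + (1 - \<theta>) * ?y powr p"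
      using 3 th p by (intro convex_onD[OF powr_convex]) auto
    moreover have "(1 - (1 - \<theta>)) *\<^sub>R ?x + (1 - \<theta>) *\<^sub>R ?y = \<alpha>" using th by simp
    moreover have "(1 - (1 - \<theta>)) * ?x powr p = \<theta> powr (1 - p) * \<beta> powr p"
      using th 3 by (simp add: powr_divide powr_diff)
    moreover have "(1 - \<theta>) * ?y powr p = (1 - \<theta>) powr (1 - p) * (\<alpha> - \<beta>) powr p"
      using th 3 by (simp add: powr_divide powr_diff)
    ultimately show ?thesis using 3 by simp
  qed
qed

lemma H_minus: "H p (- t) = - H p t"
  by (simp add: H_def)

lemma H_nonneg_eq: "0 \<le> t \<Longrightarrow> H p t = t powr (p - 1)"
  by (cases "t = 0") (simp_all add: H_def powr_diff power2_eq_square)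

text \<open>
  With \<open>t = c / a\<close>, the splitting parameter \<open>\<theta> = (1 + t) / 2\<close> makes \<open>(1 - t)\<^bsup>p-1\<^esup> (1 - \<theta>)\<^bsup>1-p\<^esup>\<close>
  constant, while \<open>t\<^bsup>1-p\<^esup> - \<theta>\<^bsup>1-p\<^esup>\<close> stays large enough to control the logarithm.
\<close>

lemma log_test_inequality_aux:
  fixes a c \<alpha> \<beta> p :: real
  assumes p: "1 < p" and c: "0 < c" and ca: "c < a" and al: "0 \<le> \<alpha>" and be: "0 \<le> \<beta>"
  shows "H p (a - c) * (\<alpha> powr p * a powr (1 - p) - (\<beta> powr p) * c powr (1 - p))
     \<le> - ((p - 1)\<^sup>2 / (2 * p)) * \<beta> powr p * \<bar>ln (a / c)\<bar> powr p
        + 2 powr (p - 1) * \<bar>\<alpha> - \<beta>\<bar> powr p"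
proof -
  define v where "v = ln (a / c)"
  define t where "t = c / a"
  define \<theta> where "\<theta> = (1 + t) / 2"
  have a: "0 < a" using c ca by simp
  have v: "0 < v" using c ca by (simp add: v_def)
  have t: "0 < t" "t < 1" using c ca by (auto simp: t_def)
  have th: "0 < \<theta>" "\<theta> < 1" using t by (auto simp: \<theta>_def)
  have ev: "exp v = 1 / t" using a c by (simp add: v_def t_def)
  \<comment> \<open>The expression is homogeneous of degree 0 in \<open>a\<close> and
    \<open>c\<close>, so only the ratio \<open>t\<close> remains.\<close>
  have "H p (a - c) * (\<alpha> powr p * a powr (1 - p) - (\<beta> powr p) * c powr (1 - p))
     = (1 - t) powr (p - 1) * (\<alpha> powr p - (\<beta> powr p) * t powr (1 - p))"
  proof -
    have "a - c = a * (1 - t)" "c = a * t" using a by (auto simp: t_def algebra_simps)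
    then have "H p (a - c) = a powr (p - 1) * (1 - t) powr (p - 1)"
      "c powr (1 - p) = a powr (1 - p) * t powr (1 - p)"
      using a t ca by (simp_all add: H_nonneg_eq powr_mult)
    moreover have "a powr (p - 1) = inverse (a powr (1 - p))"
      using a by (simp flip: powr_minus)
    moreover have "a powr (1 - p) \<noteq> 0" using a by simp
    ultimately show ?thesis by (simp add: field_simps)
  qed
  also have "\<dots> \<le> (1 - t) powr (p - 1) * ((\<theta> powr (1 - p) * \<beta> powr p
                    + (1 - \<theta>) powr (1 - p) * \<bar>\<alpha> - \<beta>\<bar> powr p) - (\<beta> powr p) * t powr (1 - p))"
    using powr_convex_split[OF p al be th] by (intro mult_left_mono) auto
  also have "\<dots> = - (\<beta> powr p) * ((1 - t) powr (p - 1) * (t powr (1 - p) - \<theta> powr (1 - p)))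
      + ((1 - t) powr (p - 1) * (1 - \<theta>) powr (1 - p)) * \<bar>\<alpha> - \<beta>\<bar> powr p"
    by (simp add: algebra_simps)
  also have "(1 - t) powr (p - 1) * (1 - \<theta>) powr (1 - p) = 2 powr (p - 1)"
  proof -
    have eq: "1 - \<theta> = (1 - t) / 2" by (simp add: \<theta>_def field_simps)
    show ?thesis unfolding eq using t by (simp add: powr_divide powr_diff)
  qed
  also have "(1 - t) powr (p - 1) * (t powr (1 - p) - \<theta> powr (1 - p))
      = (exp v - 1) powr (p - 1) * (1 - (2 / (exp v + 1)) powr (p - 1))"
  proof -
    have "exp v - 1 = (1 - t) / t" "2 / (exp v + 1) = t / \<theta>"
      using t by (auto simp: ev \<theta>_def field_simps)
    then have "(exp v - 1) powr (p - 1) = (1 - t) powr (p - 1) / t powr (p - 1)"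
      "(2 / (exp v + 1)) powr (p - 1) = t powr (p - 1) / \<theta> powr (p - 1)"
      using t th by (simp_all add: powr_divide)
    moreover have "t powr (1 - p) = 1 / t powr (p - 1)" "\<theta> powr (1 - p) = 1 / \<theta> powr (p - 1)"
      using powr_minus_divide[of t "p - 1"] powr_minus_divide[of \<theta> "p - 1"] by simp_all
    moreover have "t powr (p - 1) \<noteq> 0" "\<theta> powr (p - 1) \<noteq> 0" using t th by auto
    ultimately show ?thesis by (simp only:) (simp add: field_simps)
  qed
  also have "- (\<beta> powr p) * \<dots> \<le> - (\<beta> powr p) * ((p - 1)\<^sup>2 / (2 * p) * v powr p)"
    using log_profile_bound[OF p, of v] v by (intro mult_left_mono_neg) auto
  finally show ?thesis using v by (simp add: v_def mult_ac)
qed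

text \<open>Exchanging the two points changes the sign of both factors, so the case
  \<open>a < c\<close> reduces to \<open>c < a\<close>. The cutoff value that multiplies the
  logarithm is the one at the point with the smaller of \<open>a\<close> and \<open>c\<close>; the
  minimum covers both orders.\<close>

lemma log_test_inequality:
  fixes a c \<alpha> \<beta> p :: real
  assumes p: "1 < p" and "0 < a" "0 < c" and al: "0 \<le> \<alpha>" and be: "0 \<le> \<beta>"
  shows "H p (a - c) * (\<alpha> powr p * a powr (1 - p) - (\<beta> powr p) * c powr (1 - p))
     \<le> - ((p - 1)\<^sup>2 / (2 * p)) * min \<alpha> \<beta> powr p * \<bar>ln (a / c)\<bar> powr p
        + 2 powr (p - 1) * \<bar>\<alpha> - \<beta>\<bar> powr p"
proof -
  let ?d = "(p - 1)\<^sup>2 / (2 * p)" and ?l = "\<bar>ln (a / c)\<bar> powr p"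
  have weaken: "- ?d * \<gamma> powr p * ?l \<le> - ?d * min \<alpha> \<beta> powr p * ?l" if "min \<alpha> \<beta> \<le> \<gamma>" for \<gamma>
    using that p al be by (auto intro!: mult_right_mono mult_left_mono divide_right_mono powr_mono2)
  consider "a = c" | "c < a" | "a < c" by linarith
  then show ?thesis
  proof cases
    case 1
    then show ?thesis using assms by (simp add: H_def)
  next
    case 2
    then show ?thesis
      using log_test_inequality_aux[of p c a \<alpha> \<beta>] weaken[of \<beta>] assms by linarith
  next
    case 3
    have sw: "\<bar>ln (c / a)\<bar> = \<bar>ln (a / c)\<bar>" "H p (c - a) = - H p (a - c)"
      using assms H_minus[of p "a - c"] by (auto simp: ln_div)
    have "H p (a - c) * (\<alpha> powr p * a powr (1 - p) - (\<beta> powr p) * c powr (1 - p))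
        = H p (c - a) * (\<beta> powr p * c powr (1 - p) - \<alpha> powr p * a powr (1 - p))"
      by (simp add: sw algebra_simps)
    also have "\<dots> \<le> - ?d * \<alpha> powr p * ?l + 2 powr (p - 1) * \<bar>\<alpha> - \<beta>\<bar> powr p"
      using log_test_inequality_aux[of p a c \<beta> \<alpha>] 3 assms by (simp add: sw abs_minus_commute)
    also have "\<dots> \<le> - ?d * min \<alpha> \<beta> powr p * ?l + 2 powr (p - 1) * \<bar>\<alpha> - \<beta>\<bar> powr p"
      using weaken[of \<alpha>] by simp
    finally show ?thesis .
  qed
qed

section \<open>Lebesgue measure on the product space\<close>

text \<open>A Lebesgue set differs from a Borel set by a subset of a null set, so a Borel map whose
  preimages of null sets are null pulls Lebesgue sets back to Lebesgue sets. This is what makes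
  \<open>u (fst z)\<close> and \<open>K (fst z - snd z)\<close> measurable on the product when
  \<open>u\<close> and \<open>K\<close> are merely Lebesgue measurable.\<close>

lemma measurable_lebesgue_if_null_preserving:
  fixes T :: "'a::euclidean_space \<Rightarrow> 'b::euclidean_space"
  assumes T: "T \<in> borel \<rightarrow>\<^sub>M borel"
    and null: "\<And>N. N \<in> null_sets lborel \<Longrightarrow> T -` N \<in> null_sets lborel"
  shows "T \<in> lebesgue \<rightarrow>\<^sub>M lebesgue"
proof (rule completion.measurable_completion2)
  show T': "T \<in> lebesgue \<rightarrow>\<^sub>M lborel" using T by (simp add: measurable_completion)
  show "null_sets lborel \<subseteq> null_sets (distr lebesgue lborel T)"
  proof
    fix N :: "'b set" assume N: "N \<in> null_sets lborel"
    then have "T -` N \<in> null_sets lebesgue" using null null_sets_completionI by blast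
    with N T' show "N \<in> null_sets (distr lebesgue lborel T)"
      by (auto simp: null_sets_def emeasure_distr)
  qed
qed

lemma AE_lebesgue_vimage:
  fixes T :: "'a::euclidean_space \<Rightarrow> 'b::euclidean_space"
  assumes null: "\<And>N. N \<in> null_sets lborel \<Longrightarrow> T -` N \<in> null_sets lborel"
    and P: "AE x in lebesgue. P x"
  shows "AE z in lebesgue. P (T z)"
proof -
  have "AE x in lborel. P x" using P by (simp add: AE_completion_iff)
  from AE_E3[OF this] obtain N where N: "\<And>x. x \<in> space lborel - N \<Longrightarrow> P x" "N \<in> null_sets lborel"
    by metis
  then have "AE z in lborel. P (T z)"
    by (intro AE_I'[OF null[OF N(2)]]) auto
  then show ?thesis by (simp add: AE_completion_iff)
qed

lemma null_sets_vimage_fst: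
  fixes N :: "'a::euclidean_space set"
  shows "N \<in> null_sets lborel \<Longrightarrow>
    (fst :: 'a::euclidean_space \<times> 'b::euclidean_space \<Rightarrow> 'a) -` N \<in> null_sets lborel"
  using lborel.times_in_null_sets1[of N lborel "UNIV :: 'b set"]
  by (simp add: lborel_prod vimage_fst)

lemma null_sets_vimage_snd:
  fixes N :: "'b::euclidean_space set"
  shows "N \<in> null_sets lborel \<Longrightarrow>
    (snd :: 'a::euclidean_space \<times> 'b::euclidean_space \<Rightarrow> 'b) -` N \<in> null_sets lborel"
  using lborel.times_in_null_sets2[of "UNIV :: 'a set" lborel N]
  by (simp add: lborel_prod vimage_snd)

lemma null_sets_vimage_diff:
  fixes N :: "'a::euclidean_space set"
  assumes N: "N \<in> null_sets lborel"
  shows "(\<lambda>z. fst z - snd z) -` N \<in> null_sets lborel"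
proof -
  have [measurable]: "N \<in> sets borel" using N by auto
  have S: "(\<lambda>z::'a \<times> 'a. fst z - snd z) -` N \<in> sets (lborel \<Otimes>\<^sub>M lborel)"
  proof -
    have "(\<lambda>z::'a \<times> 'a. fst z - snd z) \<in> borel_measurable (lborel \<Otimes>\<^sub>M lborel)" by measurable
    from measurable_sets[OF this, of N] show ?thesis by (simp add: space_pair_measure)
  qed
  \<comment> \<open>For a fixed second coordinate the slice of the preimage is a translate of
    \<open>N\<close>, hence null.\<close>
  have "emeasure (lborel \<Otimes>\<^sub>M lborel) ((\<lambda>z::'a \<times> 'a. fst z - snd z) -` N)
      = (\<integral>\<^sup>+y. emeasure lborel {x. x - y \<in> N} \<partial>lborel)"
    by (subst lborel_pair.emeasure_pair_measure_alt2[OF S]) (simp add: vimage_def)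
  also have "\<dots> = 0"
    using null_sets_translation[OF N] by (simp add: null_sets_def)
  finally show ?thesis using S unfolding lborel_prod by (simp add: null_sets_def)
qed

lemma measurable_lebesgue_fst [measurable]:
  "(fst :: 'a::euclidean_space \<times> 'b::euclidean_space \<Rightarrow> 'a) \<in> lebesgue \<rightarrow>\<^sub>M lebesgue"
  by (intro measurable_lebesgue_if_null_preserving null_sets_vimage_fst
      borel_measurable_continuous_onI continuous_intros)

lemma measurable_lebesgue_snd [measurable]:
  "(snd :: 'a::euclidean_space \<times> 'b::euclidean_space \<Rightarrow> 'b) \<in> lebesgue \<rightarrow>\<^sub>M lebesgue"
  by (intro measurable_lebesgue_if_null_preserving null_sets_vimage_snd
      borel_measurable_continuous_onI continuous_intros)

lemma measurable_lebesgue_diff [measurable]: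
  "(\<lambda>z::'a::euclidean_space \<times> 'a. fst z - snd z) \<in> lebesgue \<rightarrow>\<^sub>M lebesgue"
  by (intro measurable_lebesgue_if_null_preserving null_sets_vimage_diff
      borel_measurable_continuous_onI continuous_intros)

lemma AE_lebesgue_fst:
  "AE x in lebesgue. P x \<Longrightarrow>
    AE z in (lebesgue :: ('a::euclidean_space \<times> 'b::euclidean_space) measure). P (fst z)"
  by (rule AE_lebesgue_vimage[OF null_sets_vimage_fst])

lemma AE_lebesgue_snd:
  "AE x in lebesgue. P x \<Longrightarrow>
    AE z in (lebesgue :: ('a::euclidean_space \<times> 'b::euclidean_space) measure). P (snd z)"
  by (rule AE_lebesgue_vimage[OF null_sets_vimage_snd])

text \<open>Lebesgue measure on the product is the completion of the Borel product measure, so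
  Tonelli's theorem is applied to Borel functions that agree with \<open>f\<close> and
  \<open>g\<close> almost everywhere.\<close>

lemma nn_integral_lebesgue_prod:
  fixes f :: "'a::euclidean_space \<Rightarrow> ennreal" and g :: "'b::euclidean_space \<Rightarrow> ennreal"
  assumes f: "f \<in> borel_measurable lebesgue" and g: "g \<in> borel_measurable lebesgue"
  shows "(\<integral>\<^sup>+z. f (fst z) * g (snd z) \<partial>lebesgue)
           = (\<integral>\<^sup>+x. f x \<partial>lebesgue) * (\<integral>\<^sup>+y. g y \<partial>lebesgue)"
proof -
  obtain f' where f'[measurable]: "f' \<in> borel_measurable lborel" and ff: "AE x in lebesgue. f x = f' x"
    using completion_ex_borel_measurable[OF f] by (auto simp: AE_completion_iff)
  obtain g' where g'[measurable]: "g' \<in> borel_measurable lborel" and gg: "AE x in lebesgue. g x = g' x"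
    using completion_ex_borel_measurable[OF g] by (auto simp: AE_completion_iff)
  have "AE z in lebesgue. f (fst z) * g (snd z) = f' (fst z) * g' (snd z)"
    using AE_lebesgue_fst[OF ff] AE_lebesgue_snd[OF gg]
    by eventually_elim simp
  then have "(\<integral>\<^sup>+z. f (fst z) * g (snd z) \<partial>lebesgue) = (\<integral>\<^sup>+z. f' (fst z) * g' (snd z) \<partial>lebesgue)"
    by (rule nn_integral_cong_AE)
  also have "\<dots> = (\<integral>\<^sup>+z. f' (fst z) * g' (snd z) \<partial>(lborel \<Otimes>\<^sub>M lborel))"
    by (simp add: nn_integral_completion lborel_prod)
  also have "\<dots> = (\<integral>\<^sup>+x. \<integral>\<^sup>+y. f' x * g' y \<partial>lborel \<partial>lborel)"
    by (subst lborel.nn_integral_fst[symmetric]) auto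
  also have "\<dots> = (\<integral>\<^sup>+x. f' x \<partial>lborel) * (\<integral>\<^sup>+y. g' y \<partial>lborel)"
    by (simp add: nn_integral_cmult nn_integral_multc)
  also have "\<dots> = (\<integral>\<^sup>+x. f' x \<partial>lebesgue) * (\<integral>\<^sup>+y. g' y \<partial>lebesgue)"
    by (simp add: nn_integral_completion)
  also have "\<dots> = (\<integral>\<^sup>+x. f x \<partial>lebesgue) * (\<integral>\<^sup>+y. g y \<partial>lebesgue)"
  proof -
    have "(\<integral>\<^sup>+x. f' x \<partial>lebesgue) = (\<integral>\<^sup>+x. f x \<partial>lebesgue)"
      using ff by (intro nn_integral_cong_AE) auto
    moreover have "(\<integral>\<^sup>+x. g' x \<partial>lebesgue) = (\<integral>\<^sup>+x. g x \<partial>lebesgue)"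
      using gg by (intro nn_integral_cong_AE) auto
    ultimately show ?thesis by simp
  qed
  finally show ?thesis .
qed

lemma nn_integral_translate:
  fixes k :: "'a::euclidean_space \<Rightarrow> ennreal"
  assumes [measurable]: "k \<in> borel_measurable borel"
  shows "(\<integral>\<^sup>+x. k (x - c) \<partial>lborel) = (\<integral>\<^sup>+x. k x \<partial>lborel)"
proof -
  have "(\<integral>\<^sup>+x. k x \<partial>lborel) = (\<integral>\<^sup>+x. k x \<partial>distr lborel borel ((+) (- c)))"
    by (simp add: lborel_distr_plus)
  also have "\<dots> = (\<integral>\<^sup>+x. k (x - c) \<partial>lborel)"
    by (subst nn_integral_distr) (auto simp: algebra_simps)
  finally show ?thesis by simp
qed

text \<open>Tonelli's theorem and translation invariance. Evenness turns \<open>k (x - y)\<close>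
  into a translate of \<open>k\<close> in the inner variable \<open>y\<close>.\<close>

lemma nn_integral_convolution_fst:
  fixes f k :: "'a::euclidean_space \<Rightarrow> ennreal"
  assumes [measurable]: "f \<in> borel_measurable borel" "k \<in> borel_measurable borel"
    and even: "\<And>z. k (- z) = k z"
  shows "(\<integral>\<^sup>+z. f (fst z) * k (fst z - snd z) \<partial>lebesgue) = (\<integral>\<^sup>+x. f x \<partial>lborel) * (\<integral>\<^sup>+z. k z \<partial>lborel)"
proof -
  have "(\<integral>\<^sup>+z. f (fst z) * k (fst z - snd z) \<partial>lebesgue)
      = (\<integral>\<^sup>+z. f (fst z) * k (fst z - snd z) \<partial>(lborel \<Otimes>\<^sub>M lborel))"
    by (simp add: nn_integral_completion lborel_prod)
  also have "\<dots> = (\<integral>\<^sup>+x. \<integral>\<^sup>+y. f x * k (x - y) \<partial>lborel \<partial>lborel)"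
    by (subst lborel.nn_integral_fst[symmetric]) auto
  also have "\<dots> = (\<integral>\<^sup>+x. f x * (\<integral>\<^sup>+y. k (y - x) \<partial>lborel) \<partial>lborel)"
    using even[of "_ - _"] by (simp add: nn_integral_cmult)
  finally show ?thesis by (simp add: nn_integral_translate nn_integral_multc)
qed

lemma nn_integral_convolution_snd:
  fixes f k :: "'a::euclidean_space \<Rightarrow> ennreal"
  assumes [measurable]: "f \<in> borel_measurable borel" "k \<in> borel_measurable borel"
  shows "(\<integral>\<^sup>+z. f (snd z) * k (fst z - snd z) \<partial>lebesgue) = (\<integral>\<^sup>+x. f x \<partial>lborel) * (\<integral>\<^sup>+z. k z \<partial>lborel)"
proof -
  have "(\<integral>\<^sup>+z. f (snd z) * k (fst z - snd z) \<partial>lebesgue)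
      = (\<integral>\<^sup>+z. f (snd z) * k (fst z - snd z) \<partial>(lborel \<Otimes>\<^sub>M lborel))"
    by (simp add: nn_integral_completion lborel_prod)
  also have "\<dots> = (\<integral>\<^sup>+y. \<integral>\<^sup>+x. f y * k (x - y) \<partial>lborel \<partial>lborel)"
    by (subst lborel_pair.nn_integral_snd[symmetric]) auto
  finally show ?thesis by (simp add: nn_integral_cmult nn_integral_translate nn_integral_multc)
qed

section \<open>The integral of the singular kernel against the increment of a cutoff\<close>

lemma ennreal_sum_of_products:
  "0 \<le> a \<Longrightarrow> 0 \<le> b \<Longrightarrow> 0 \<le> c \<Longrightarrow> 0 \<le> d \<Longrightarrow>
    ennreal a * ennreal b + ennreal c * ennreal d = ennreal (a * b + c * d)"
  by (simp add: ennreal_mult)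

text \<open>The numerator is, up to a constant, the \<open>p\<close>-th power of the largest
  increment over the vector \<open>z\<close> of a Lipschitz cutoff of scale \<open>r\<close>. With
  \<open>a = n + p * s\<close> the quotient behaves like \<open>norm z powr (p - p * s - n)\<close>
  near 0 and like \<open>norm z powr (- (p * s) - n)\<close> at infinity, so it is integrable at
  both ends when \<open>0 < s < 1\<close>.\<close>

definition cut_kernel :: "real \<Rightarrow> real \<Rightarrow> real \<Rightarrow> 'a::euclidean_space \<Rightarrow> real" where
  "cut_kernel p a r z = min 1 (norm z / r) powr p / norm z powr a"

lemma cut_kernel_measurable [measurable]: "cut_kernel p a r \<in> borel_measurable borel"
  unfolding cut_kernel_def by measurable

lemma cut_kernel_nonneg: "0 \<le> cut_kernel p a r z"
  by (simp add: cut_kernel_def)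

lemma cut_kernel_even: "cut_kernel p a r (- z) = cut_kernel p a r z"
  by (simp add: cut_kernel_def)

text \<open>The two fractions come from integrating the radial powers over \<open>[0, r]\<close> and
  \<open>[r, \<infinity>)\<close>; the power of 2 is the price of the dyadic averaging in the next
  proof.\<close>

definition cut_kernel_const :: "nat \<Rightarrow> real \<Rightarrow> real \<Rightarrow> real" where
  "cut_kernel_const n p s =
     2 powr (real n + p * s + 1) * unit_ball_vol (real n) * (1 / (p - p * s) + 1 / (p * s))"

text \<open>
  The radial profile is dominated by its average over \<open>[\<bar>z\<bar>, 2 \<bar>z\<bar>]\<close>, which turns the
  integral over space into a one-dimensional integral of ball volumes.
\<close>

lemma nn_integral_cut_kernel_le:
  fixes p s r :: real
  defines "n \<equiv> DIM('a::euclidean_space)"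
  assumes p: "0 < p" and s: "0 < s" "s < 1" and r: "0 < r"
  shows "(\<integral>\<^sup>+(z::'a). ennreal (cut_kernel p (real n + p * s) r z) \<partial>lborel)
           \<le> ennreal (cut_kernel_const n p s * r powr (- (p * s)))"
proof -
  define a where "a = real n + p * s"
  define W where "W t = 2 powr (a + 1) * (min 1 (t / r) powr p * t powr (- a - 1))" for t :: real
  define \<omega> where "\<omega> = unit_ball_vol (real n)"
  have a: "0 < a" using p s by (simp add: a_def add_nonneg_pos)
  have [measurable]: "W \<in> borel_measurable borel" unfolding W_def by measurable
  have W0: "0 \<le> W t" for t by (simp add: W_def)
  have pointwise: "ennreal (cut_kernel p a r z)
      \<le> (\<integral>\<^sup>+t. ennreal (W t) * indicator {norm z..2 * norm z} t \<partial>lborel)" for z :: 'a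
  proof (cases "z = 0")
    case True then show ?thesis using p r by (simp add: cut_kernel_def)
  next
    case False
    define \<rho> where "\<rho> = norm z"
    have rho: "0 < \<rho>" using False by (simp add: \<rho>_def)
    \<comment> \<open>The first factor of \<open>W\<close> increases, so
      \<open>t \<ge> \<rho>\<close> is used; the second decreases, so
      \<open>t \<le> 2 * \<rho>\<close> is used, and \<open>2 powr (a + 1)\<close> compensates for
      evaluating it at \<open>2 * \<rho>\<close>. The division by \<rho> is by the length of the
      interval.\<close>
    have "cut_kernel p a r z / \<rho> \<le> W t" if "t \<in> {\<rho>..2 * \<rho>}" for t
    proof -
      have "cut_kernel p a r z / \<rho> = 2 powr (a + 1) * (min 1 (\<rho> / r) powr p * (2 * \<rho>) powr (- a - 1))"
        using rho by (simp add: cut_kernel_def \<rho>_def powr_diff powr_minus powr_add powr_mult field_simps)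
      also have "\<dots> \<le> W t"
      proof -
        have "min 1 (\<rho> / r) \<le> min 1 (t / r)"
          using that r by (intro min.mono divide_right_mono) auto
        then have "min 1 (\<rho> / r) powr p \<le> min 1 (t / r) powr p"
          using rho r p by (intro powr_mono2) auto
        moreover have "(2 * \<rho>) powr (- a - 1) \<le> t powr (- a - 1)"
          using that rho a by (intro powr_mono2') auto
        ultimately show ?thesis
          unfolding W_def by (intro mult_left_mono mult_mono) auto
      qed
      finally show ?thesis .
    qed
    then have "(\<integral>\<^sup>+t. ennreal (cut_kernel p a r z / \<rho>) * indicator {\<rho>..2 * \<rho>} t \<partial>lborel)
        \<le> (\<integral>\<^sup>+t. ennreal (W t) * indicator {\<rho>..2 * \<rho>} t \<partial>lborel)"
      by (intro nn_integral_mono) (auto simp: indicator_def intro: ennreal_leI)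
    also have "(\<integral>\<^sup>+t. ennreal (cut_kernel p a r z / \<rho>) * indicator {\<rho>..2 * \<rho>} t \<partial>lborel)
        = ennreal (cut_kernel p a r z)"
      using rho cut_kernel_nonneg[of p a r z] by (simp add: nn_integral_cmult ennreal_mult'[symmetric])
    finally show ?thesis by (simp add: \<rho>_def)
  qed
  have "(\<integral>\<^sup>+(z::'a). ennreal (cut_kernel p a r z) \<partial>lborel)
      \<le> (\<integral>\<^sup>+(z::'a). \<integral>\<^sup>+t. ennreal (W t) * indicator {norm z..2 * norm z} t \<partial>lborel \<partial>lborel)"
    by (intro nn_integral_mono pointwise)
  also have "\<dots> \<le> (\<integral>\<^sup>+(z::'a). \<integral>\<^sup>+t. ennreal (W t) * (if norm z \<le> t then 1 else 0) \<partial>lborel \<partial>lborel)"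
    by (intro nn_integral_mono) (auto simp: indicator_def)
  also have "\<dots> = (\<integral>\<^sup>+t. \<integral>\<^sup>+(z::'a). ennreal (W t) * (if norm z \<le> t then 1 else 0) \<partial>lborel \<partial>lborel)"
    by (rule lborel_pair.Fubini') measurable
  also have "\<dots> \<le> (\<integral>\<^sup>+t. ennreal (2 powr (a + 1) * \<omega> * r powr (- p)) * ennreal (indicator {0..r} t * t powr (p - p * s - 1))
      + ennreal (2 powr (a + 1) * \<omega>) * ennreal (indicator {r..} t * t powr (- (p * s) - 1)) \<partial>lborel)"
  proof (rule nn_integral_mono)
    fix t :: real
    have "(\<integral>\<^sup>+(z::'a). ennreal (W t) * (if norm z \<le> t then 1 else 0) \<partial>lborel)
        = (\<integral>\<^sup>+(z::'a). ennreal (W t) * indicator (cball 0 t) z \<partial>lborel)"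
      by (intro nn_integral_cong) (auto simp: indicator_def)
    also have "\<dots> = ennreal (W t) * emeasure lborel (cball (0::'a) t)"
      by (rule nn_integral_cmult_indicator) simp
    also have "\<dots> \<le> ennreal (2 powr (a + 1) * \<omega> * r powr (- p)) * ennreal (indicator {0..r} t * t powr (p - p * s - 1))
      + ennreal (2 powr (a + 1) * \<omega>) * ennreal (indicator {r..} t * t powr (- (p * s) - 1))"
    proof (cases "0 < t")
      case False
      then have "W t = 0 \<or> cball (0::'a) t = {}" using p by (cases "t = 0") (auto simp: W_def)
      then show ?thesis by auto
    next
      case True
      have *: "W t * (\<omega> * t ^ n) = 2 powr (a + 1) * \<omega> * (min 1 (t / r) powr p * t powr (- (p * s) - 1))"
        using True by (simp add: W_def a_def powr_diff powr_minus powr_add powr_realpow field_simps)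
      have "min 1 (t / r) powr p * t powr (- (p * s) - 1)
         \<le> r powr (- p) * (indicator {0..r} t * t powr (p - p * s - 1)) + indicator {r..} t * t powr (- (p * s) - 1)"
      proof (cases "t \<le> r")
        case le: True
        then have "min 1 (t / r) powr p * t powr (- (p * s) - 1) = r powr (- p) * t powr (p - p * s - 1)"
          using True r by (simp add: powr_divide powr_diff powr_minus powr_add field_simps)
        then show ?thesis using le True by (auto simp: indicator_def)
      qed (use r in \<open>auto simp: indicator_def field_simps\<close>)
      then have le: "W t * (\<omega> * t ^ n) \<le> 2 powr (a + 1) * \<omega> *
          (r powr (- p) * (indicator {0..r} t * t powr (p - p * s - 1)) + indicator {r..} t * t powr (- (p * s) - 1))"
        unfolding * by (intro mult_left_mono) (auto simp: \<omega>_def)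
      have "ennreal (W t) * emeasure lborel (cball (0::'a) t) = ennreal (W t * (\<omega> * t ^ n))"
        using True W0 by (simp add: emeasure_cball n_def \<omega>_def ennreal_mult')
      also have "\<dots> \<le> ennreal (2 powr (a + 1) * \<omega> *
          (r powr (- p) * (indicator {0..r} t * t powr (p - p * s - 1)) + indicator {r..} t * t powr (- (p * s) - 1)))"
        by (rule ennreal_leI[OF le])
      also have "\<dots> = ennreal (2 powr (a + 1) * \<omega> * r powr (- p)) * ennreal (indicator {0..r} t * t powr (p - p * s - 1))
      + ennreal (2 powr (a + 1) * \<omega>) * ennreal (indicator {r..} t * t powr (- (p * s) - 1))"
        by (subst ennreal_sum_of_products) (auto simp: \<omega>_def algebra_simps)
      finally show ?thesis .
    qed
    finally show "(\<integral>\<^sup>+(z::'a). ennreal (W t) * (if norm z \<le> t then 1 else 0) \<partial>lborel)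
      \<le> ennreal (2 powr (a + 1) * \<omega> * r powr (- p)) * ennreal (indicator {0..r} t * t powr (p - p * s - 1))
      + ennreal (2 powr (a + 1) * \<omega>) * ennreal (indicator {r..} t * t powr (- (p * s) - 1))" .
  qed
  also have "\<dots> = ennreal (2 powr (a + 1) * \<omega> * r powr (- p)) * ennreal (r powr (p - p * s) / (p - p * s))
      + ennreal (2 powr (a + 1) * \<omega>) * ennreal (r powr (- (p * s)) / (p * s))"
  proof -
    have ps: "0 < p * s" "p * s < p" using p s by auto
    have "(\<integral>\<^sup>+t. ennreal (indicator {0..r} t * t powr (p - p * s - 1)) \<partial>lborel) = ennreal (r powr (p - p * s) / (p - p * s))"
      using has_integral_powr_from_0[of "p - p * s - 1" r] ps r
      by (intro nn_integral_has_integral_lebesgue) auto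
    moreover have "(\<integral>\<^sup>+t. ennreal (indicator {r..} t * t powr (- (p * s) - 1)) \<partial>lborel) = ennreal (r powr (- (p * s)) / (p * s))"
      using has_integral_powr_to_inf[of "- (p * s) - 1" r] ps r
      by (intro nn_integral_has_integral_lebesgue) auto
    ultimately show ?thesis
      by (subst nn_integral_add) (auto simp: nn_integral_cmult)
  qed
  also have "\<dots> = ennreal (cut_kernel_const n p s * r powr (- (p * s)))"
  proof -
    have ps: "0 < p * s" "p * s < p" using p s by auto
    have "r powr (- p) * r powr (p - p * s) = r powr (- (p * s))" by (simp flip: powr_add)
    then have "2 powr (a + 1) * \<omega> * r powr (- p) * (r powr (p - p * s) / (p - p * s))
       + 2 powr (a + 1) * \<omega> * (r powr (- (p * s)) / (p * s)) = cut_kernel_const n p s * r powr (- (p * s))"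
      by (simp add: cut_kernel_const_def a_def \<omega>_def algebra_simps)
    then show ?thesis using ps s
      by (subst ennreal_sum_of_products) (auto simp: \<omega>_def intro!: divide_nonneg_nonneg)
  qed
  finally show ?thesis by (simp add: a_def)
qed

section \<open>Cutoff and logarithmic test function\<close>

text \<open>The estimate through the maximum is valid for every positive exponent; it is also used
  with \<open>p - 1\<close>, which may be below 1.\<close>

lemma powr_add_le:
  fixes x y a :: real
  assumes "0 \<le> x" "0 \<le> y" "0 < a"
  shows "(x + y) powr a \<le> 2 powr a * (x powr a + y powr a)"
proof -
  have "(x + y) powr a \<le> (2 * max x y) powr a" using assms by (intro powr_mono2) auto
  also have "\<dots> = 2 powr a * max x y powr a" using assms by (simp add: powr_mult)
  also have "\<dots> \<le> 2 powr a * (x powr a + y powr a)"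
    by (intro mult_left_mono) (auto simp: max_def)
  finally show ?thesis .
qed

lemma powr_diff_le:
  fixes x y p :: real
  assumes p: "1 < p" and "0 \<le> x" "x \<le> 1" "0 \<le> y" "y \<le> 1"
  shows "\<bar>x powr p - y powr p\<bar> \<le> p * \<bar>x - y\<bar>"
proof -
  have *: "y powr p - x powr p \<le> p * (y - x)" if "0 \<le> x" "x < y" "y \<le> 1" for x y :: real
  proof -
    have D: "((\<lambda>t. t powr p) has_real_derivative p * z powr (p - 1)) (at z)" if "x < z" for z
      using that \<open>0 \<le> x\<close> by (intro has_real_derivative_powr) auto
    have "\<exists>l z. x < z \<and> z < y \<and> ((\<lambda>t. t powr p) has_real_derivative l) (at z) \<and>
        y powr p - x powr p = (y - x) * l"
    proof (rule MVT)
      show "continuous_on {x..y} (\<lambda>t. t powr p)"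
        using that p by (intro continuous_on_powr' continuous_intros) auto
      show "(\<lambda>t. t powr p) differentiable (at z)" if "x < z" "z < y" for z
        using D[OF that(1)] by (auto simp: real_differentiable_def)
    qed (use that in auto)
    then obtain l z where z: "x < z" "z < y" "((\<lambda>t. t powr p) has_real_derivative l) (at z)"
      "y powr p - x powr p = (y - x) * l" by blast
    have "l = p * z powr (p - 1)"
      by (rule DERIV_unique[OF z(3) D[OF z(1)]])
    moreover have "z powr (p - 1) \<le> 1" using z that p by (simp add: powr_le1)
    ultimately have "l \<le> p" using p by simp
    then have "(y - x) * l \<le> (y - x) * p" using that by (intro mult_left_mono) auto
    then show ?thesis using z by (simp add: mult.commute)
  qed
  have mono: "x powr p \<le> y powr p" if "0 \<le> x" "x \<le> y" for x y :: real
    using that p by (intro powr_mono2) auto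
  consider "x < y" | "x = y" | "y < x" by linarith
  then show ?thesis
    using *[of x y] *[of y x] mono[of x y] mono[of y x] assms by cases auto
qed

lemma powr_neg_diff_le:
  fixes x y b p :: real
  assumes p: "1 < p" and b: "0 < b" "b \<le> x" "b \<le> y"
  shows "\<bar>x powr (1 - p) - y powr (1 - p)\<bar> \<le> (p - 1) * b powr (- p) * \<bar>x - y\<bar>"
proof -
  have *: "x powr (1 - p) - y powr (1 - p) \<le> (p - 1) * b powr (- p) * (y - x)"
    if "b \<le> x" "x < y" for x y :: real
  proof -
    have "\<exists>z>x. z < y \<and> y powr (1 - p) - x powr (1 - p) = (y - x) * ((1 - p) * z powr (1 - p - 1))"
      using that b by (intro MVT2 has_real_derivative_powr) auto
    then obtain z where z: "x < z" "z < y"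
      "x powr (1 - p) - y powr (1 - p) = (y - x) * ((p - 1) * z powr (- p))"
      by (auto simp: algebra_simps)
    have "z powr (- p) \<le> b powr (- p)" using that z b p by (intro powr_mono2') auto
    then have "(y - x) * ((p - 1) * z powr (- p)) \<le> (y - x) * ((p - 1) * b powr (- p))"
      using that p by (intro mult_left_mono) auto
    then show ?thesis using z by (simp add: mult_ac)
  qed
  have mono: "y powr (1 - p) \<le> x powr (1 - p)" if "b \<le> x" "x \<le> y" for x y :: real
    using that p b by (intro powr_mono2') auto
  consider "x < y" | "x = y" | "y < x" by linarith
  then show ?thesis
    using *[of x y] *[of y x] mono[of x y] mono[of y x] assms by cases auto
qed

text \<open>In units of \<open>r\<close>, the affine profile takes the value 1 at distance 1 and 0
  at distance 3/2. As \<open>R > 2 * r\<close>, the support keeps a distance of at least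
  \<open>r / 2\<close> from the complement of the ball of radius \<open>R\<close>.\<close>

definition cutoff :: "'a::euclidean_space \<Rightarrow> real \<Rightarrow> 'a \<Rightarrow> real" where
  "cutoff x0 r x = max 0 (min 1 (3 - 2 * (dist x0 x / r)))"

lemma cutoff_bounds: "0 \<le> cutoff x0 r x" "cutoff x0 r x \<le> 1"
  by (auto simp: cutoff_def)

lemma cutoff_eq_1: "0 < r \<Longrightarrow> x \<in> ball x0 r \<Longrightarrow> cutoff x0 r x = 1"
  by (auto simp: cutoff_def field_simps)

lemma cutoff_eq_0: "0 < r \<Longrightarrow> x \<notin> ball x0 (3 * r / 2) \<Longrightarrow> cutoff x0 r x = 0"
  by (auto simp: cutoff_def field_simps)

lemma cutoff_measurable [measurable]: "cutoff x0 r \<in> borel_measurable borel"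
  unfolding cutoff_def by measurable

lemma cutoff_Lipschitz:
  assumes "0 < r"
  shows "\<bar>cutoff x0 r x - cutoff x0 r y\<bar> \<le> 2 * min 1 (norm (x - y) / r)"
proof -
  have "\<bar>cutoff x0 r x - cutoff x0 r y\<bar> \<le> 2 * \<bar>dist x0 x / r - dist x0 y / r\<bar>"
  proof -
    have "\<bar>max 0 (min 1 (3 - 2 * a)) - max 0 (min 1 (3 - 2 * c))\<bar> \<le> 2 * \<bar>a - c\<bar>" for a c :: real
      by (auto simp: max_def min_def abs_if)
    then show ?thesis unfolding cutoff_def .
  qed
  also have "\<bar>dist x0 x / r - dist x0 y / r\<bar> = \<bar>dist x0 x - dist x0 y\<bar> / r"
    using assms by (simp flip: diff_divide_distrib)
  also have "\<dots> \<le> norm (x - y) / r"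
    using assms dist_triangle[of x0 x y] dist_triangle[of x0 y x]
    by (intro divide_right_mono) (auto simp: dist_norm norm_minus_commute abs_le_iff)
  finally have "\<bar>cutoff x0 r x - cutoff x0 r y\<bar> \<le> 2 * (norm (x - y) / r)" by simp
  moreover have "\<bar>cutoff x0 r x - cutoff x0 r y\<bar> \<le> 2"
    using cutoff_bounds[of x0 r x] cutoff_bounds[of x0 r y] by auto
  ultimately show ?thesis by (auto simp: min_def)
qed

lemma cutoff_diff_powr_le:
  assumes "0 < r" "0 < p"
  shows "\<bar>cutoff x0 r x - cutoff x0 r y\<bar> powr p
    \<le> 2 powr p * ((indicator (ball x0 (3 * r / 2)) x + indicator (ball x0 (3 * r / 2)) y)
        * min 1 (norm (x - y) / r) powr p)"
proof (cases "x \<in> ball x0 (3 * r / 2) \<or> y \<in> ball x0 (3 * r / 2)")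
  case True
  have "\<bar>cutoff x0 r x - cutoff x0 r y\<bar> powr p \<le> (2 * min 1 (norm (x - y) / r)) powr p"
    using assms cutoff_Lipschitz by (intro powr_mono2) auto
  also have "\<dots> = 2 powr p * (1 * min 1 (norm (x - y) / r) powr p)"
    using assms by (simp add: powr_mult)
  also have "\<dots> \<le> 2 powr p * ((indicator (ball x0 (3 * r / 2)) x + indicator (ball x0 (3 * r / 2)) y)
        * min 1 (norm (x - y) / r) powr p)"
    using True by (intro mult_left_mono mult_right_mono) (auto simp: indicator_def)
  finally show ?thesis .
next
  case False
  then show ?thesis using assms cutoff_eq_0[of r x x0] cutoff_eq_0[of r y x0] by simp
qed

section \<open>The test function and its pointwise energy\<close>

definition log_test :: "real \<Rightarrow> real \<Rightarrow> 'a::euclidean_space \<Rightarrow> real \<Rightarrow> ('a \<Rightarrow> real) \<Rightarrow> 'a \<Rightarrow> real" where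
  "log_test p b x0 r u x = cutoff x0 r x powr p * (max (u x) 0 + b) powr (1 - p)"

lemma log_test_nonneg: "0 \<le> log_test p b x0 r u x"
  by (simp add: log_test_def)

lemma log_test_le:
  assumes "1 < p" "0 < b"
  shows "log_test p b x0 r u x \<le> b powr (1 - p)"
proof -
  have "cutoff x0 r x powr p \<le> 1" using cutoff_bounds[of x0 r x] assms by (intro powr_le1) auto
  moreover have "(max (u x) 0 + b) powr (1 - p) \<le> b powr (1 - p)"
    using assms by (intro powr_mono2') auto
  ultimately have "log_test p b x0 r u x \<le> 1 * b powr (1 - p)"
    unfolding log_test_def by (intro mult_mono) auto
  then show ?thesis by simp
qed

lemma log_test_eq_0: "0 < r \<Longrightarrow> x \<notin> ball x0 (3 * r / 2) \<Longrightarrow> log_test p b x0 r u x = 0"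
  by (simp add: log_test_def cutoff_eq_0)

text \<open>A discrete product rule: the negative power has Lipschitz constant
  \<open>(p - 1) * b powr (- p)\<close> on \<open>[b, \<infinity>)\<close>, and the power of the
  cutoff has constant \<open>p\<close> on \<open>[0, 1]\<close>. The test function thereby inherits
  a finite Gagliardo seminorm from \<open>u\<close> and the cutoff.\<close>

lemma log_test_diff_le:
  assumes p: "1 < p" and b: "0 < b"
  shows "\<bar>log_test p b x0 r u x - log_test p b x0 r u y\<bar>
    \<le> (p - 1) * b powr (- p) * \<bar>u x - u y\<bar> + b powr (1 - p) * p * \<bar>cutoff x0 r x - cutoff x0 r y\<bar>"
proof -
  let ?c = "\<lambda>x. cutoff x0 r x powr p" and ?w = "\<lambda>x. (max (u x) 0 + b) powr (1 - p)"
  have "log_test p b x0 r u x - log_test p b x0 r u y = ?c x * (?w x - ?w y) + ?w y * (?c x - ?c y)"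
    by (simp add: log_test_def algebra_simps)
  then have "\<bar>log_test p b x0 r u x - log_test p b x0 r u y\<bar>
      \<le> \<bar>?c x * (?w x - ?w y)\<bar> + \<bar>?w y * (?c x - ?c y)\<bar>"
    by (metis abs_triangle_ineq)
  also have "\<bar>?c x * (?w x - ?w y)\<bar> \<le> 1 * ((p - 1) * b powr (- p) * \<bar>u x - u y\<bar>)"
  proof -
    have "?c x \<le> 1" using cutoff_bounds[of x0 r x] p by (intro powr_le1) auto
    moreover have "\<bar>?w x - ?w y\<bar> \<le> (p - 1) * b powr (- p) * \<bar>(max (u x) 0 + b) - (max (u y) 0 + b)\<bar>"
      using p b by (intro powr_neg_diff_le) auto
    moreover have "\<dots> \<le> (p - 1) * b powr (- p) * \<bar>u x - u y\<bar>"
      using p by (intro mult_left_mono) auto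
    ultimately show ?thesis unfolding abs_mult by (intro mult_mono) auto
  qed
  also have "\<bar>?w y * (?c x - ?c y)\<bar> \<le> b powr (1 - p) * (p * \<bar>cutoff x0 r x - cutoff x0 r y\<bar>)"
  proof -
    have "?w y \<le> b powr (1 - p)" using p b by (intro powr_mono2') auto
    moreover have "\<bar>?c x - ?c y\<bar> \<le> p * \<bar>cutoff x0 r x - cutoff x0 r y\<bar>"
      using p cutoff_bounds by (intro powr_diff_le) auto
    ultimately show ?thesis unfolding abs_mult by (intro mult_mono) auto
  qed
  finally show ?thesis by (simp add: mult_ac)
qed

lemma log_test_diff_powr_le:
  assumes p: "1 < p" and b: "0 < b" and r: "0 < r"
  shows "\<bar>log_test p b x0 r u x - log_test p b x0 r u y\<bar> powr p
    \<le> 2 powr p * ((p - 1) * b powr (- p)) powr p * \<bar>u x - u y\<bar> powr p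
      + 2 powr p * (b powr (1 - p) * p) powr p * 2 powr p *
        ((indicator (ball x0 (3 * r / 2)) x + indicator (ball x0 (3 * r / 2)) y)
        * min 1 (norm (x - y) / r) powr p)"
proof -
  have "\<bar>log_test p b x0 r u x - log_test p b x0 r u y\<bar> powr p
    \<le> ((p - 1) * b powr (- p) * \<bar>u x - u y\<bar> + b powr (1 - p) * p * \<bar>cutoff x0 r x - cutoff x0 r y\<bar>) powr p"
    using log_test_diff_le[OF p b] p by (intro powr_mono2) auto
  also have "\<dots> \<le> 2 powr p * (((p - 1) * b powr (- p) * \<bar>u x - u y\<bar>) powr p
      + (b powr (1 - p) * p * \<bar>cutoff x0 r x - cutoff x0 r y\<bar>) powr p)"
    using p b by (intro powr_add_le) auto
  also have "\<dots> = 2 powr p * ((p - 1) * b powr (- p)) powr p * \<bar>u x - u y\<bar> powr p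
      + 2 powr p * (b powr (1 - p) * p) powr p * \<bar>cutoff x0 r x - cutoff x0 r y\<bar> powr p"
    by (subst (1 2) powr_mult) (simp only: distrib_left mult.assoc)
  also have "2 powr p * (b powr (1 - p) * p) powr p * \<bar>cutoff x0 r x - cutoff x0 r y\<bar> powr p
      \<le> 2 powr p * (b powr (1 - p) * p) powr p * (2 powr p *
        ((indicator (ball x0 (3 * r / 2)) x + indicator (ball x0 (3 * r / 2)) y)
        * min 1 (norm (x - y) / r) powr p))"
    using p r by (intro mult_left_mono cutoff_diff_powr_le) auto
  finally show ?thesis by (simp add: mult_ac)
qed

text \<open>At a far point nothing is known about the sign of \<open>u\<close>. A positive value
  there only lowers the energy integrand, so the negative part suffices. The contribution of
  \<open>u x\<close> is bounded because
  \<open>u x powr (p - 1) * (u x + b) powr (1 - p) \<le> 1\<close>; the constant is stated in the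
  form of a cutoff increment so that it merges with the term for nearby pairs.\<close>

lemma log_test_far_bound:
  assumes p: "1 < p" and b: "0 < b" and r: "0 < r" and R: "2 * r < R"
    and x: "x \<in> ball x0 (3 * r / 2)" and y: "y \<notin> ball x0 R" and u: "0 \<le> u x"
  shows "H p (u x - u y) * log_test p b x0 r u x
     \<le> 4 powr p * min 1 (norm (x - y) / r) powr p
       + 2 powr (p - 1) * b powr (1 - p) * neg_part u y powr (p - 1)"
proof -
  define N where "N = neg_part u y"
  define w where "w = (u x + b) powr (1 - p)"
  have w0: "0 \<le> w" by (simp add: w_def)
  have N: "0 \<le> N" "- u y \<le> N" by (auto simp: N_def neg_part_def)
  have H: "H p (u x - u y) \<le> 2 powr (p - 1) * (u x powr (p - 1) + N powr (p - 1))"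
  proof (cases "0 \<le> u x - u y")
    case True
    then have "H p (u x - u y) = (u x - u y) powr (p - 1)" by (rule H_nonneg_eq)
    also have "\<dots> \<le> (u x + N) powr (p - 1)" using True N p by (intro powr_mono2) auto
    also have "\<dots> \<le> 2 powr (p - 1) * (u x powr (p - 1) + N powr (p - 1))"
      using u N p by (intro powr_add_le) auto
    finally show ?thesis .
  next
    case False
    then have "H p (u x - u y) \<le> 0" by (auto simp: H_def intro: mult_nonneg_nonpos)
    also have "0 \<le> 2 powr (p - 1) * (u x powr (p - 1) + N powr (p - 1))" by simp
    finally show ?thesis .
  qed
  have t: "log_test p b x0 r u x \<le> w"
  proof -
    have "cutoff x0 r x powr p \<le> 1" using cutoff_bounds[of x0 r x] p by (intro powr_le1) auto
    then show ?thesis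
      using u mult_right_mono[of "cutoff x0 r x powr p" 1 w] w0 by (simp add: log_test_def w_def)
  qed
  have "H p (u x - u y) * log_test p b x0 r u x
      \<le> 2 powr (p - 1) * (u x powr (p - 1) + N powr (p - 1)) * log_test p b x0 r u x"
    by (intro mult_right_mono H log_test_nonneg)
  also have "\<dots> \<le> 2 powr (p - 1) * (u x powr (p - 1) + N powr (p - 1)) * w"
    by (intro mult_left_mono t) simp
  also have "\<dots> = 2 powr (p - 1) * (u x powr (p - 1) * w) + 2 powr (p - 1) * w * N powr (p - 1)"
    by (simp add: algebra_simps)
  also have "2 powr (p - 1) * (u x powr (p - 1) * w) \<le> 4 powr p * min 1 (norm (x - y) / r) powr p"
  proof -
    have "u x powr (p - 1) * w \<le> (u x + b) powr (p - 1) * w"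
      using u b p w0 by (intro mult_right_mono powr_mono2) auto
    also have "\<dots> = 1" using u b by (simp add: w_def flip: powr_add)
    finally have 1: "2 powr (p - 1) * (u x powr (p - 1) * w) \<le> 2 powr p * 1"
      using p by (intro mult_mono powr_mono) (auto simp: w0)
    \<comment> \<open>\<open>y\<close> is at distance more than \<open>2 * r\<close> and
      \<open>x\<close> at distance less than \<open>3 * r / 2\<close> from the centre, so
      \<open>norm (x - y) \<ge> r / 2\<close>; this is where the base 4 comes from.\<close>
    have "dist x0 y \<le> dist x0 x + norm (x - y)" using dist_triangle[of x0 y x] by (simp add: dist_norm)
    then have "1 / 2 \<le> min 1 (norm (x - y) / r)" using x y R r by (auto simp: field_simps)
    then have "(1 / 2) powr p \<le> min 1 (norm (x - y) / r) powr p" using p by (intro powr_mono2) auto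
    then have "4 powr p * (1 / 2) powr p \<le> 4 powr p * min 1 (norm (x - y) / r) powr p"
      by (intro mult_left_mono) auto
    moreover have "4 powr p * (1 / 2) powr p = 2 powr p" by (simp flip: powr_mult)
    ultimately show ?thesis using 1 by simp
  qed
  also have "2 powr (p - 1) * w * N powr (p - 1) \<le> 2 powr (p - 1) * b powr (1 - p) * N powr (p - 1)"
    using u b p by (intro mult_left_mono mult_right_mono) (auto simp: w_def intro!: powr_mono2')
  finally show ?thesis by (simp add: N_def)
qed

text \<open>Pairs inside the ball of radius \<open>R\<close> fall under the logarithmic inequality,
  pairs with one far point under \<open>log_test_far_bound\<close>, whose two orders are exchanged
  by the oddness of \<open>H\<close>. The sign of \<open>u\<close> is assumed at the two given
  points only, so the inequality can later be applied almost everywhere.\<close>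

lemma log_test_pointwise:
  fixes x y x0 :: "'a::euclidean_space"
  assumes p: "1 < p" and b: "0 < b" and r: "0 < r" and R: "2 * r < R"
    and ux: "x \<in> ball x0 R \<Longrightarrow> 0 \<le> u x" and uy: "y \<in> ball x0 R \<Longrightarrow> 0 \<le> u y"
  defines "B \<equiv> ball x0 (3 * r / 2)"
  shows "H p (u x - u y) * (log_test p b x0 r u x - log_test p b x0 r u y)
      + (p - 1)\<^sup>2 / (2 * p) *
        (indicator (ball x0 r \<times> ball x0 r) (x, y) * \<bar>ln ((u x + b) / (u y + b))\<bar> powr p)
     \<le> 4 powr p * ((indicator B x + indicator B y) * min 1 (norm (x - y) / r) powr p)
       + 2 powr (p - 1) * b powr (1 - p) *
         (indicator B x * (indicator (- ball x0 R) y * neg_part u y powr (p - 1))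
          + indicator B y * (indicator (- ball x0 R) x * neg_part u x powr (p - 1)))"
    (is "?F + ?d * (?I * ?L) \<le> ?G + ?c * ?T")
proof -
  have G: "0 \<le> ?G" by simp
  have T: "0 \<le> ?c * ?T" by simp
  have sub: "ball x0 r \<subseteq> B" "B \<subseteq> ball x0 R" "ball x0 r \<subseteq> ball x0 R" using r R by (auto simp: B_def)
  \<comment> \<open>A point outside the ball of radius \<open>R\<close> is outside \<open>B\<close>.
    Hence a pair not in the first case either misses \<open>B\<close> or joins a point of
    \<open>B\<close> to a far point.\<close>
  consider "x \<in> ball x0 R" "y \<in> ball x0 R" | "x \<notin> B" "y \<notin> B" "x \<notin> ball x0 r"
    | "x \<in> B" "y \<notin> ball x0 R" | "y \<in> B" "x \<notin> ball x0 R"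
    using sub by blast
  then show ?thesis
  proof cases
    case 1
    let ?m = "min (cutoff x0 r x) (cutoff x0 r y)"
    have u: "0 \<le> u x" "0 \<le> u y" using 1 ux uy by auto
    have "?F = H p ((u x + b) - (u y + b)) * (cutoff x0 r x powr p * (u x + b) powr (1 - p)
        - cutoff x0 r y powr p * (u y + b) powr (1 - p))"
      using u by (simp add: log_test_def)
    also have "\<dots> \<le> - ?d * ?m powr p * ?L + 2 powr (p - 1) * \<bar>cutoff x0 r x - cutoff x0 r y\<bar> powr p"
      using u b p cutoff_bounds by (intro log_test_inequality) auto
    finally have F: "?F \<le> - (?d * (?m powr p * ?L))
        + 2 powr (p - 1) * \<bar>cutoff x0 r x - cutoff x0 r y\<bar> powr p" by (simp only: mult_minus_left mult.assoc)
    \<comment> \<open>Both cutoff values are 1 on the inner ball; elsewhere the logarithmic gain is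
      discarded.\<close>
    have "?I \<le> ?m powr p"
      using r cutoff_eq_1[of r x x0] cutoff_eq_1[of r y x0] by (auto simp: indicator_def)
    then have "?d * (?I * ?L) \<le> ?d * (?m powr p * ?L)"
      using p by (intro mult_left_mono mult_right_mono) auto
    moreover have "2 powr (p - 1) * \<bar>cutoff x0 r x - cutoff x0 r y\<bar> powr p \<le> ?G"
    proof -
      have "2 powr (p - 1) * \<bar>cutoff x0 r x - cutoff x0 r y\<bar> powr p
          \<le> 2 powr p * (2 powr p * ((indicator B x + indicator B y) * min 1 (norm (x - y) / r) powr p))"
        using p r unfolding B_def by (intro mult_mono powr_mono cutoff_diff_powr_le) auto
      also have "\<dots> = ?G" by (simp add: mult.assoc[symmetric] flip: powr_mult)
      finally show ?thesis .
    qed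
    ultimately show ?thesis using F T by linarith
  next
    case 2
    then have "?F = 0" "?I = 0" using r by (auto simp: B_def log_test_eq_0)
    moreover from this have "?d * (?I * ?L) = 0" by simp
    ultimately show ?thesis using G T by linarith
  next
    case 3
    then have "y \<notin> B" "y \<notin> ball x0 r" "x \<in> ball x0 R" using sub by auto
    then have "?F = H p (u x - u y) * log_test p b x0 r u x"
      "?G = 4 powr p * min 1 (norm (x - y) / r) powr p"
      "?c * ?T = ?c * neg_part u y powr (p - 1)" "?I = 0"
      using 3 r by (simp_all add: B_def log_test_eq_0)
    moreover from this have "?d * (?I * ?L) = 0" by simp
    moreover have "0 \<le> u x" using ux \<open>x \<in> ball x0 R\<close> by simp
    moreover have "x \<in> ball x0 (3 * r / 2)" using 3 by (simp add: B_def)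
    ultimately show ?thesis
      using log_test_far_bound[OF p b r R, of x x0 y u] 3 by linarith
  next
    case 4
    then have *: "x \<notin> B" "x \<notin> ball x0 r" "y \<in> ball x0 R" using sub by auto
    then have "?F = H p (u y - u x) * log_test p b x0 r u y"
      "?G = 4 powr p * min 1 (norm (y - x) / r) powr p"
      "?c * ?T = ?c * neg_part u x powr (p - 1)" "?I = 0"
      using 4 r H_minus[of p "u x - u y"] by (simp_all add: B_def log_test_eq_0 norm_minus_commute)
    moreover from this have "?d * (?I * ?L) = 0" by simp
    moreover have "0 \<le> u y" using uy * by simp
    moreover have "y \<in> ball x0 (3 * r / 2)" using 4 by (simp add: B_def)
    ultimately show ?thesis
      using log_test_far_bound[OF p b r R, of y x0 x u] 4 by linarith
  qed
qed

text \<open>Above the threshold, \<open>(v / \<tau>) powr (q - 1) \<ge> 1\<close>.\<close>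

lemma young_truncation:
  fixes v \<tau> q :: real
  assumes "1 \<le> q" "0 < \<tau>" "0 \<le> v"
  shows "v \<le> \<tau> + \<tau> powr (1 - q) * v powr q"
proof (cases "v \<le> \<tau>")
  case False
  then have "v = v powr (1 - q) * v powr q" using assms by (simp flip: powr_add)
  also have "\<dots> \<le> \<tau> powr (1 - q) * v powr q"
    using False assms by (intro mult_right_mono powr_mono2') auto
  finally show ?thesis using assms by simp
qed (simp add: add_increasing2)

section \<open>Integral estimates\<close>

lemma kernel_const_pos:
  assumes "0 < p" "s < 1"
  shows "0 < kernel_const n p s"
  using assms by (auto simp: kernel_const_def intro!: divide_pos_pos mult_pos_pos Gamma_real_pos add_nonneg_pos)

lemma kernel_density_measurable [measurable]:
  fixes K :: "real^'n \<Rightarrow> real"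
  assumes "K \<in> borel_measurable lebesgue"
  shows "(\<lambda>(x, y). ennreal (K (x - y))) \<in> borel_measurable lebesgue"
  using measurable_compose[OF measurable_lebesgue_diff assms] by (simp add: split_beta)

lemma is_kernelD:
  fixes K :: "real^'n \<Rightarrow> real"
  assumes "is_kernel s p lam Lam K"
  shows "K \<in> borel_measurable lebesgue" and "\<And>y. y \<noteq> 0 \<Longrightarrow> 0 < K y"
    and "\<And>y. y \<noteq> 0 \<Longrightarrow> K y \<le> kernel_const CARD('n) p s * Lam / norm y powr (real CARD('n) + p * s)"
  using assms unfolding is_kernel_def by blast+

lemma sets_kernel_measure [measurable_cong]: "sets (kernel_measure K) = sets lebesgue"
  by (simp add: kernel_measure_def)

text \<open>Replaces the kernel by its upper bound. On the diagonal \<open>K 0\<close> is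
  unconstrained, and the vanishing of \<open>f\<close> there removes these points without a null set
  argument.\<close>

lemma nn_integral_kernel_measure_le:
  fixes K :: "real^'n \<Rightarrow> real" and f :: "(real^'n) \<times> (real^'n) \<Rightarrow> real"
  assumes K: "is_kernel s p lam Lam K" and f: "f \<in> borel_measurable lebesgue"
    and f0: "\<And>z. 0 \<le> f z" and diag: "\<And>x. f (x, x) = 0"
    and g: "\<And>z. fst z \<noteq> snd z \<Longrightarrow> f z / norm (fst z - snd z) powr (real CARD('n) + p * s) \<le> g z"
    and gm: "g \<in> borel_measurable lebesgue"
    and k: "0 \<le> kernel_const CARD('n) p s * Lam"
  shows "(\<integral>\<^sup>+z. ennreal (f z) \<partial>kernel_measure K)
    \<le> ennreal (kernel_const CARD('n) p s * Lam) * (\<integral>\<^sup>+z. ennreal (g z) \<partial>lebesgue)"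
proof -
  let ?c = "kernel_const CARD('n) p s * Lam"
  have "(\<integral>\<^sup>+z. ennreal (f z) \<partial>kernel_measure K)
      = (\<integral>\<^sup>+z. (case z of (x, y) \<Rightarrow> ennreal (K (x - y))) * ennreal (f z) \<partial>lebesgue)"
    unfolding kernel_measure_def using is_kernelD(1)[OF K] f
    by (intro nn_integral_density kernel_density_measurable) auto
  also have "\<dots> \<le> (\<integral>\<^sup>+z. ennreal ?c * ennreal (g z) \<partial>lebesgue)"
  proof (rule nn_integral_mono)
    fix z :: "(real^'n) \<times> (real^'n)"
    show "(case z of (x, y) \<Rightarrow> ennreal (K (x - y))) * ennreal (f z) \<le> ennreal ?c * ennreal (g z)"
    proof (cases "fst z = snd z")
      case True
      then have "f z = 0" using diag[of "fst z"] by (cases z) simp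
      then show ?thesis by simp
    next
      case False
      let ?a = "norm (fst z - snd z) powr (real CARD('n) + p * s)"
      have Kz: "0 < K (fst z - snd z)" "K (fst z - snd z) \<le> ?c / ?a"
        using is_kernelD(2,3)[OF K] False by auto
      have "K (fst z - snd z) * f z \<le> ?c / ?a * f z" using Kz f0 by (intro mult_right_mono)
      also have "\<dots> = ?c * (f z / ?a)" by simp
      also have "\<dots> \<le> ?c * g z" using k g[OF False] by (intro mult_left_mono)
      finally have "ennreal (K (fst z - snd z) * f z) \<le> ennreal (?c * g z)" by (rule ennreal_leI)
      then show ?thesis using Kz k by (simp add: split_beta ennreal_mult')
    qed
  qed
  also have "\<dots> = ennreal ?c * (\<integral>\<^sup>+z. ennreal (g z) \<partial>lebesgue)"
    using gm by (intro nn_integral_cmult) simp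
  finally show ?thesis .
qed

lemma nn_integral_near_diagonal_le:
  fixes x0 :: "'a::euclidean_space"
  assumes p: "0 < p" and s: "0 < s" "s < 1" and r: "0 < r" and \<rho>: "0 \<le> \<rho>"
  shows "(\<integral>\<^sup>+z. ennreal ((indicator (ball x0 \<rho>) (fst z) + indicator (ball x0 \<rho>) (snd z))
            * cut_kernel p (real DIM('a) + p * s) r (fst z - snd z)) \<partial>lebesgue)
     \<le> ennreal (2 * (unit_ball_vol (real DIM('a)) * \<rho> ^ DIM('a)) * (cut_kernel_const DIM('a) p s * r powr (- (p * s))))"
proof -
  let ?B = "ball x0 \<rho>"
  define k where "k = (\<lambda>z::'a. ennreal (cut_kernel p (real DIM('a) + p * s) r z))"
  define \<beta> where "\<beta> = (\<lambda>x. indicator ?B x :: ennreal)"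
  have [measurable]: "k \<in> borel_measurable borel" unfolding k_def by measurable
  have [measurable]: "\<beta> \<in> borel_measurable borel"
    unfolding \<beta>_def by (intro borel_measurable_indicator) simp
  have dbl: "ennreal (2 * c) = 2 * ennreal c" for c by (simp add: ennreal_mult')
  have even: "k (- z) = k z" for z by (simp add: k_def cut_kernel_even)
  have "(\<lambda>z. \<beta> (fst z) * k (fst z - snd z)) \<in> borel_measurable (lborel \<Otimes>\<^sub>M lborel)"
    "(\<lambda>z. \<beta> (snd z) * k (fst z - snd z)) \<in> borel_measurable (lborel \<Otimes>\<^sub>M lborel)"
    by measurable
  then have meas: "(\<lambda>z. \<beta> (fst z) * k (fst z - snd z)) \<in> borel_measurable lebesgue"
    "(\<lambda>z. \<beta> (snd z) * k (fst z - snd z)) \<in> borel_measurable lebesgue"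
    unfolding lborel_prod by (auto intro: measurable_completion)
  have "(\<integral>\<^sup>+z. ennreal ((indicator ?B (fst z) + indicator ?B (snd z))
            * cut_kernel p (real DIM('a) + p * s) r (fst z - snd z)) \<partial>lebesgue)
      = (\<integral>\<^sup>+z. \<beta> (fst z) * k (fst z - snd z) + \<beta> (snd z) * k (fst z - snd z) \<partial>lebesgue)"
  proof (rule nn_integral_cong)
    fix z :: "'a \<times> 'a"
    define c where "c = cut_kernel p (real DIM('a) + p * s) r (fst z - snd z)"
    have c: "0 \<le> c" by (simp add: c_def cut_kernel_nonneg)
    have "ennreal ((indicator ?B (fst z) + indicator ?B (snd z)) * c)
        = ennreal (indicator ?B (fst z) * c) + ennreal (indicator ?B (snd z) * c)"
      unfolding distrib_right using c by (intro ennreal_plus) auto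
    also have "\<dots> = \<beta> (fst z) * ennreal c + \<beta> (snd z) * ennreal c"
      by (simp add: \<beta>_def ennreal_mult' ennreal_indicator)
    finally show "ennreal ((indicator ?B (fst z) + indicator ?B (snd z))
          * cut_kernel p (real DIM('a) + p * s) r (fst z - snd z))
        = \<beta> (fst z) * k (fst z - snd z) + \<beta> (snd z) * k (fst z - snd z)"
      by (simp only: k_def c_def)
  qed
  also have "\<dots> = (\<integral>\<^sup>+z. \<beta> (fst z) * k (fst z - snd z) \<partial>lebesgue) + (\<integral>\<^sup>+z. \<beta> (snd z) * k (fst z - snd z) \<partial>lebesgue)"
    by (rule nn_integral_add) (rule meas)+
  also have "\<dots> = 2 * ((\<integral>\<^sup>+x. \<beta> x \<partial>lborel) * (\<integral>\<^sup>+z. k z \<partial>lborel))"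
  proof -
    have "(\<integral>\<^sup>+z. \<beta> (fst z) * k (fst z - snd z) \<partial>lebesgue) = (\<integral>\<^sup>+x. \<beta> x \<partial>lborel) * (\<integral>\<^sup>+z. k z \<partial>lborel)"
      by (rule nn_integral_convolution_fst) (fact | rule even)+
    moreover have "(\<integral>\<^sup>+z. \<beta> (snd z) * k (fst z - snd z) \<partial>lebesgue) = (\<integral>\<^sup>+x. \<beta> x \<partial>lborel) * (\<integral>\<^sup>+z. k z \<partial>lborel)"
      by (rule nn_integral_convolution_snd) fact+
    ultimately show ?thesis by (simp only: mult_2)
  qed
  also have "(\<integral>\<^sup>+x. \<beta> x \<partial>lborel) = emeasure lborel ?B" by (simp add: \<beta>_def)
  also have "2 * (emeasure lborel ?B * (\<integral>\<^sup>+z. k z \<partial>lborel))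
      \<le> 2 * (emeasure lborel ?B * ennreal (cut_kernel_const DIM('a) p s * r powr (- (p * s))))"
    unfolding k_def by (intro mult_left_mono nn_integral_cut_kernel_le p s r) auto
  also have "\<dots> = ennreal (2 * (unit_ball_vol (real DIM('a)) * \<rho> ^ DIM('a)) * (cut_kernel_const DIM('a) p s * r powr (- (p * s))))"
  proof -
    have "0 \<le> cut_kernel_const DIM('a) p s * r powr (- (p * s))"
      using p s unfolding cut_kernel_const_def
      by (intro mult_nonneg_nonneg add_nonneg_nonneg divide_nonneg_nonneg) auto
    then show ?thesis
      using \<rho> by (simp only: emeasure_ball[OF \<rho>] mult.assoc[of 2] dbl)
        (subst ennreal_mult'', auto)
  qed
  finally show ?thesis .
qed

text \<open>Replacing the distance from \<open>y\<close> to \<open>x\<close> by the distance from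
  \<open>y\<close> to the centre decouples the variables: the integral becomes the volume of
  \<open>B\<close> times the unnormalised tail integral \<open>T\<close>.\<close>

lemma nn_integral_far_le:
  fixes N :: "'a::euclidean_space \<Rightarrow> real" and x0 x y :: 'a
  assumes N: "N \<in> borel_measurable lebesgue" "\<And>y. 0 \<le> N y" and a: "0 \<le> a"
    and r: "0 < r" and R: "2 * r < R"
  defines "B \<equiv> ball x0 (3 * r / 2)"
  defines "W \<equiv> (\<lambda>y. 4 powr a * (indicator (- ball x0 R) y * (N y / norm (y - x0) powr a)))"
  defines "T \<equiv> \<integral>\<^sup>+y\<in>- ball x0 R. ennreal (N y / norm (y - x0) powr a) \<partial>lebesgue"
  shows "(\<integral>\<^sup>+z. ennreal (indicator B (fst z) * W (snd z)) \<partial>lebesgue)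
       = ennreal (4 powr a) * emeasure lebesgue B * T"
    and "(\<integral>\<^sup>+z. ennreal (indicator B (snd z) * W (fst z)) \<partial>lebesgue)
       = ennreal (4 powr a) * emeasure lebesgue B * T"
    and "x \<in> B \<Longrightarrow> y \<notin> ball x0 R \<Longrightarrow> N y / norm (x - y) powr a \<le> W y"
proof -
  have W0: "0 \<le> W y" for y using N by (simp add: W_def)
  have "(\<lambda>y. norm (y - x0) powr a) \<in> borel_measurable lborel" by measurable
  from N(1) measurable_completion[OF this]
  have NW[measurable]: "(\<lambda>y. N y / norm (y - x0) powr a) \<in> borel_measurable lebesgue"
    by (rule borel_measurable_divide)
  have [measurable]: "W \<in> borel_measurable lebesgue" 
    unfolding W_def by (intro borel_measurable_times borel_measurable_const borel_measurable_indicator NW) simp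
  have B: "B \<in> sets lebesgue" by (simp add: B_def)
  have "(\<integral>\<^sup>+y. ennreal (W y) \<partial>lebesgue)
      = (\<integral>\<^sup>+y. ennreal (4 powr a) * (ennreal (N y / norm (y - x0) powr a) * indicator (- ball x0 R) y) \<partial>lebesgue)"
    unfolding W_def by (intro nn_integral_cong) (simp add: ennreal_mult'[symmetric] split: split_indicator)
  also have "\<dots> = ennreal (4 powr a) * T"
    unfolding T_def
    by (intro nn_integral_cmult borel_measurable_times_ennreal borel_measurable_indicator
        measurable_compose[OF NW measurable_ennreal]) simp
  finally have WT: "(\<integral>\<^sup>+y. ennreal (W y) \<partial>lebesgue) = ennreal (4 powr a) * T" .
  have "(\<integral>\<^sup>+z. ennreal (indicator B (fst z) * W (snd z)) \<partial>lebesgue)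
      = (\<integral>\<^sup>+z. indicator B (fst z) * ennreal (W (snd z)) \<partial>lebesgue)"
    by (intro nn_integral_cong) (auto simp: indicator_def)
  also have "\<dots> = (\<integral>\<^sup>+x. indicator B x \<partial>lebesgue) * (\<integral>\<^sup>+y. ennreal (W y) \<partial>lebesgue)"
    using B by (intro nn_integral_lebesgue_prod) auto
  finally show "(\<integral>\<^sup>+z. ennreal (indicator B (fst z) * W (snd z)) \<partial>lebesgue)
       = ennreal (4 powr a) * emeasure lebesgue B * T"
    using B by (simp add: WT mult_ac)
  have "(\<integral>\<^sup>+z. ennreal (indicator B (snd z) * W (fst z)) \<partial>lebesgue)
      = (\<integral>\<^sup>+z. ennreal (W (fst z)) * indicator B (snd z) \<partial>lebesgue)"
    by (intro nn_integral_cong) (auto simp: indicator_def)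
  also have "\<dots> = (\<integral>\<^sup>+y. ennreal (W y) \<partial>lebesgue) * (\<integral>\<^sup>+x. indicator B x \<partial>lebesgue)"
    using B by (intro nn_integral_lebesgue_prod) auto
  finally show "(\<integral>\<^sup>+z. ennreal (indicator B (snd z) * W (fst z)) \<partial>lebesgue)
       = ennreal (4 powr a) * emeasure lebesgue B * T"
    using B by (simp add: WT mult_ac)
  show "N y / norm (x - y) powr a \<le> W y" if "x \<in> B" "y \<notin> ball x0 R"
  proof -
    \<comment> \<open>\<open>3 * r / 2\<close> is less than three quarters of
      \<open>norm (y - x0)\<close>, because the latter is at least \<open>R > 2 * r\<close>; a
      quarter remains for \<open>norm (x - y)\<close>.\<close>
    have "dist x0 y \<le> dist x0 x + norm (x - y)" using dist_triangle[of x0 y x] by (simp add: dist_norm)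
    then have le: "norm (y - x0) / 4 \<le> norm (x - y)" and pos: "0 < norm (y - x0)"
      using that r R by (auto simp: B_def dist_norm norm_minus_commute)
    then have pos2: "0 < norm (x - y)" by linarith
    have "(norm (y - x0) / 4) powr a \<le> norm (x - y) powr a" using a le by (intro powr_mono2) auto
    then have "N y / norm (x - y) powr a \<le> N y / (norm (y - x0) / 4) powr a"
      using pos le N pos2 by (intro divide_left_mono mult_pos_pos) auto
    also have "\<dots> = W y" using that by (simp add: W_def powr_divide)
    finally show ?thesis .
  qed
qed

text \<open>\<open>L\<close> may have infinite integral, so it is not split off from an integral. If
  \<open>G\<close> has infinite integral the claim is trivial; otherwise \<open>G - F\<close> is
  integrable and dominates \<open>L\<close> almost everywhere.\<close>

lemma nn_integral_absorb:
  assumes F: "integrable M F" and G[measurable]: "G \<in> borel_measurable M"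
    and le: "AE z in M. F z + L z \<le> G z" and nonneg: "\<And>z. 0 \<le> L z" "\<And>z. 0 \<le> G z"
    and v: "- v \<le> (\<integral>z. F z \<partial>M)" "0 \<le> v"
  shows "(\<integral>\<^sup>+z. ennreal (L z) \<partial>M) \<le> (\<integral>\<^sup>+z. ennreal (G z) \<partial>M) + ennreal v"
proof (cases "(\<integral>\<^sup>+z. ennreal (G z) \<partial>M) = \<infinity>")
  case False
  have iG: "integrable M G"
    using False nonneg by (intro integrableI_bounded) (auto simp: top.not_eq_extremum)
  have "(\<integral>\<^sup>+z. ennreal (L z) \<partial>M) \<le> (\<integral>\<^sup>+z. ennreal (G z - F z) \<partial>M)"
    using le by (intro nn_integral_mono_AE) (auto elim!: eventually_mono intro!: ennreal_leI)
  also have "\<dots> = ennreal (\<integral>z. G z - F z \<partial>M)"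
  proof (intro nn_integral_eq_integral)
    show "AE z in M. 0 \<le> G z - F z"
      using le by eventually_elim (use nonneg in \<open>smt (verit)\<close>)
  qed (use iG F in auto)
  also have "\<dots> \<le> ennreal ((\<integral>z. G z \<partial>M) + v)"
    using v iG F by (intro ennreal_leI) simp
  also have "\<dots> = (\<integral>\<^sup>+z. ennreal (G z) \<partial>M) + ennreal v"
    using iG nonneg v by (simp add: nn_integral_eq_integral ennreal_plus)
  finally show ?thesis .
qed simp

lemma powr_mult_le_add:
  fixes x y p :: real
  assumes "1 < p" "0 \<le> x" "0 \<le> y"
  shows "x powr (p - 1) * y \<le> x powr p + y powr p"
proof -
  have m: "max x y powr p = max x y powr (p - 1) * max x y"
    using assms by (cases "max x y = 0") (auto simp: powr_diff)
  have "x powr (p - 1) * y \<le> max x y powr (p - 1) * max x y"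
    using assms by (intro mult_mono powr_mono2) auto
  also have "\<dots> \<le> x powr p + y powr p" unfolding m[symmetric] by (auto simp: max_def)
  finally show ?thesis .
qed

lemma Lq_norm_cases:
  fixes f :: "real^'n \<Rightarrow> real"
  assumes "0 < q"
  obtains "Lq_norm q \<Omega> f = \<infinity>"
  | N where "0 \<le> N" "Lq_norm q \<Omega> f = ennreal N"
      "(\<integral>\<^sup>+x\<in>\<Omega>. ennreal (\<bar>f x\<bar> powr q) \<partial>lebesgue) = ennreal (N powr q)"
proof (cases "(\<integral>\<^sup>+x\<in>\<Omega>. ennreal (\<bar>f x\<bar> powr q) \<partial>lebesgue)")
  case (real I)
  then show ?thesis
    using that(2)[of "I powr (1 / q)"] assms by (simp add: Lq_norm_def epowr_def powr_powr)
next
  case top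
  then show ?thesis using that(1) by (simp add: Lq_norm_def epowr_def)
qed

text \<open>
  The exponent \<open>q\<close> does not enter the constant: truncating at height \<open>(1 + N) r powr (- n / q)\<close>
  replaces Hoelder's inequality and needs no case distinction on the norm \<open>N\<close>.
\<close>

lemma nn_integral_ball_le_Lq_norm:
  fixes f :: "real^'n \<Rightarrow> real" and x0 :: "real^'n"
  assumes f[measurable]: "f \<in> borel_measurable lebesgue" and q: "1 \<le> q" and t: "0 < t"
    and nq: "real CARD('n) / q < t"
    and r: "0 < r" "r \<le> D" and m: "0 \<le> m" and sub: "ball x0 (m * r) \<subseteq> \<Omega>" and \<Omega>: "\<Omega> \<in> sets lebesgue"
  shows "(\<integral>\<^sup>+x\<in>ball x0 (m * r). ennreal \<bar>f x\<bar> \<partial>lebesgue)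
    \<le> ennreal ((unit_ball_vol (real CARD('n)) * m ^ CARD('n) + 1) * max 1 D powr t
          * r powr (real CARD('n) - t)) * (1 + Lq_norm q \<Omega> f)"
proof -
  let ?n = "real CARD('n)" and ?B = "ball x0 (m * r)"
  let ?C = "unit_ball_vol ?n * m ^ CARD('n) + 1"
  have C: "0 < ?C" using m by (simp add: add_nonneg_pos)
  have q0: "0 < q" using q by simp
  show ?thesis
  proof (cases rule: Lq_norm_cases[OF q0, of \<Omega> f])
    case 1
    \<comment> \<open>The convention that 0 times \<infinity> is 0 makes positivity of the
      coefficient matter here.\<close>
    have "0 < ?C * max 1 D powr t * r powr (?n - t)" using C r by (intro mult_pos_pos) auto
    then have "ennreal (?C * max 1 D powr t * r powr (?n - t)) \<noteq> 0"
      by (simp only: ennreal_eq_0_iff not_le)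
    then show ?thesis unfolding 1 by (simp only: infinity_ennreal_def add_top_right_ennreal ennreal_mult_top if_False top_greatest)
  next
    case (2 N)
    define \<tau> where "\<tau> = (1 + N) * r powr (- ?n / q)"
    have tau: "0 < \<tau>" using 2 r by (simp add: \<tau>_def add_pos_nonneg)
    have "(\<integral>\<^sup>+x\<in>?B. ennreal \<bar>f x\<bar> \<partial>lebesgue)
        \<le> (\<integral>\<^sup>+x. ennreal \<tau> * indicator ?B x
            + ennreal (\<tau> powr (1 - q)) * (ennreal (\<bar>f x\<bar> powr q) * indicator \<Omega> x) \<partial>lebesgue)"
    proof (intro nn_integral_mono)
      fix x
      have "ennreal \<bar>f x\<bar> \<le> ennreal (\<tau> + \<tau> powr (1 - q) * \<bar>f x\<bar> powr q)"
        by (intro ennreal_leI young_truncation q tau) simp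
      also have "\<dots> = ennreal \<tau> + ennreal (\<tau> powr (1 - q)) * ennreal (\<bar>f x\<bar> powr q)"
        using tau by (simp add: ennreal_mult)
      finally show "ennreal \<bar>f x\<bar> * indicator ?B x \<le> ennreal \<tau> * indicator ?B x
            + ennreal (\<tau> powr (1 - q)) * (ennreal (\<bar>f x\<bar> powr q) * indicator \<Omega> x)"
        using sub by (auto simp: indicator_def)
    qed
    also have "\<dots> = ennreal \<tau> * emeasure lebesgue ?B + ennreal (\<tau> powr (1 - q)) * ennreal (N powr q)"
    proof -
      have "(\<lambda>x. ennreal \<tau> * indicator ?B x) \<in> borel_measurable lebesgue"
        by (intro borel_measurable_times_ennreal borel_measurable_indicator) auto
      moreover have "(\<lambda>x. ennreal (\<bar>f x\<bar> powr q) * indicator \<Omega> x) \<in> borel_measurable lebesgue"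
        using \<Omega> by measurable
      ultimately show ?thesis
        using 2 by (simp add: nn_integral_add nn_integral_cmult nn_integral_cmult_indicator)
    qed
    also have "\<dots> = ennreal (\<tau> * (unit_ball_vol ?n * (m * r) ^ CARD('n)) + \<tau> powr (1 - q) * N powr q)"
      using tau m r by (simp add: emeasure_ball ennreal_mult)
    also have "\<dots> \<le> ennreal (?C * max 1 D powr t * r powr (?n - t) * (1 + N))"
    proof (rule ennreal_leI)
      have "\<tau> * (unit_ball_vol ?n * (m * r) ^ CARD('n)) = (1 + N) * (unit_ball_vol ?n * m ^ CARD('n)) * r powr (?n - ?n / q)"
        using r by (simp add: \<tau>_def power_mult_distrib powr_diff powr_minus powr_realpow field_simps)
      moreover have "\<tau> powr (1 - q) * N powr q \<le> (1 + N) * r powr (?n - ?n / q)"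
      proof -
        have "\<tau> powr (1 - q) = (1 + N) powr (1 - q) * r powr (?n - ?n / q)"
        proof -
          have "- ?n / q * (1 - q) = ?n - ?n / q" using q0 by (simp add: field_simps)
          then show ?thesis unfolding \<tau>_def using 2 r by (subst powr_mult) (simp_all only: powr_powr)
        qed
        moreover have "(1 + N) powr (1 - q) * N powr q \<le> (1 + N) powr (1 - q) * (1 + N) powr q"
          using 2 q by (intro mult_left_mono powr_mono2) auto
        moreover have "(1 + N) powr (1 - q) * (1 + N) powr q = 1 + N" using 2 by (simp flip: powr_add)
        ultimately show ?thesis
          using mult_right_mono[of "(1 + N) powr (1 - q) * N powr q" "1 + N" "r powr (?n - ?n / q)"]
          by (simp add: mult_ac)
      qed
      ultimately have "\<tau> * (unit_ball_vol ?n * (m * r) ^ CARD('n)) + \<tau> powr (1 - q) * N powr q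
          \<le> (1 + N) * ?C * r powr (?n - ?n / q)"
        by (simp add: algebra_simps)
      \<comment> \<open>The surplus exponent \<open>t - ?n / q\<close> is positive and depends on
        \<open>q\<close>. Bounding \<open>r\<close> by \<open>max 1 D\<close>, which is at least 1,
        allows the exponent to be raised to \<open>t\<close>, and \<open>q\<close> disappears from
        the constant.\<close>
      also have "r powr (?n - ?n / q) = r powr (?n - t) * r powr (t - ?n / q)" by (simp flip: powr_add)
      also have "(1 + N) * ?C * \<dots> \<le> (1 + N) * ?C * (r powr (?n - t) * max 1 D powr t)"
      proof -
        have "r powr (t - ?n / q) \<le> max 1 D powr (t - ?n / q)" using r nq by (intro powr_mono2) auto
        also have "\<dots> \<le> max 1 D powr t" using q by (intro powr_mono) auto
        finally show ?thesis using C 2 by (intro mult_left_mono) auto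
      qed
      finally show "\<tau> * (unit_ball_vol ?n * (m * r) ^ CARD('n)) + \<tau> powr (1 - q) * N powr q
          \<le> ?C * max 1 D powr t * r powr (?n - t) * (1 + N)" by (simp add: mult_ac)
    qed
    also have "\<dots> = ennreal (?C * max 1 D powr t * r powr (?n - t)) * (1 + Lq_norm q \<Omega> f)"
      using C 2 by (simp add: ennreal_mult flip: ennreal_1 ennreal_plus)
    finally show ?thesis .
  qed
qed

text \<open>The cone over the sphere is the closed unit ball without its centre. Positivity is
  needed to undo the division by this measure in the tail.\<close>

lemma surface_measure_sphere_pos: "0 < surface_measure (sphere (0 :: real^'n) 1)"
proof -
  have "{t *\<^sub>R \<theta> | t \<theta>. 0 < t \<and> t \<le> 1 \<and> \<theta> \<in> sphere (0 :: real^'n) 1} = cball 0 1 - {0}"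
  proof (intro equalityI subsetI)
    fix x :: "real^'n" assume x: "x \<in> cball 0 1 - {0}"
    then have "x = norm x *\<^sub>R (x /\<^sub>R norm x)" "norm (x /\<^sub>R norm x) = 1" by auto
    then show "x \<in> {t *\<^sub>R \<theta> | t \<theta>. 0 < t \<and> t \<le> 1 \<and> \<theta> \<in> sphere (0 :: real^'n) 1}"
      using x by (intro CollectI exI[of _ "norm x"] exI[of _ "x /\<^sub>R norm x"]) auto
  qed auto
  moreover have "measure lebesgue (cball (0 :: real^'n) 1 - {0}) = measure lebesgue (cball (0 :: real^'n) 1)"
    by (intro measure_Diff_null_set) (auto intro: null_sets_completionI)
  ultimately show ?thesis
    by (simp add: surface_measure_def content_cball_gt_0_iff)
qed

section \<open>Admissibility of the test function\<close>

lemma Lq_loc_nn_integral_finite: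
  fixes f :: "real^'n \<Rightarrow> real"
  assumes f: "f \<in> Lq_loc q" and q: "1 \<le> q" and C: "compact C"
  shows "(\<integral>\<^sup>+x\<in>C. ennreal \<bar>f x\<bar> \<partial>lebesgue) < \<infinity>"
proof -
  have C': "C \<in> sets lebesgue" using C by (simp add: borel_compact)
  have [measurable]: "f \<in> borel_measurable lebesgue" using f by (simp add: Lq_loc_def)
  have "(\<integral>\<^sup>+x\<in>C. ennreal \<bar>f x\<bar> \<partial>lebesgue)
      \<le> (\<integral>\<^sup>+x. indicator C x + ennreal (\<bar>f x\<bar> powr q) * indicator C x \<partial>lebesgue)"
  proof (rule nn_integral_mono)
    fix x
    have "ennreal \<bar>f x\<bar> \<le> ennreal (1 + \<bar>f x\<bar> powr q)"
      using young_truncation[of q 1 "\<bar>f x\<bar>"] q by (intro ennreal_leI) simp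
    then show "ennreal \<bar>f x\<bar> * indicator C x \<le> indicator C x + ennreal (\<bar>f x\<bar> powr q) * indicator C x"
      by (simp add: indicator_def)
  qed
  also have "\<dots> = emeasure lebesgue C + (\<integral>\<^sup>+x\<in>C. ennreal (\<bar>f x\<bar> powr q) \<partial>lebesgue)"
    using C' by (subst nn_integral_add) auto
  also have "\<dots> < \<infinity>"
  proof -
    have "emeasure lebesgue C < \<infinity>"
      using emeasure_compact_finite[OF C] borel_compact[OF C] by simp
    then show ?thesis using f C by (auto simp: Lq_loc_def ennreal_add_less_top less_top)
  qed
  finally show ?thesis .
qed

lemma log_test_measurable:
  fixes u :: "real^'n \<Rightarrow> real"
  assumes [measurable]: "u \<in> borel_measurable lebesgue"
  shows "log_test p b x0 r u \<in> borel_measurable lebesgue"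
proof -
  have [measurable]: "cutoff x0 r \<in> borel_measurable lebesgue"
    by (simp add: measurable_completion)
  show ?thesis unfolding log_test_def by measurable
qed

lemma gagliardo_integrand_measurable:
  fixes v :: "real^'n \<Rightarrow> real"
  assumes [measurable]: "v \<in> borel_measurable lebesgue"
  shows "(\<lambda>z. \<bar>v (fst z) - v (snd z)\<bar> powr p / norm (fst z - snd z) powr a) \<in> borel_measurable lebesgue"
proof -
  have "(\<lambda>y::real^'n. norm y powr a) \<in> borel_measurable lborel" by measurable
  from measurable_compose[OF measurable_lebesgue_diff measurable_completion[OF this]]
  have [measurable]: "(\<lambda>z::(real^'n) \<times> (real^'n). norm (fst z - snd z) powr a) \<in> borel_measurable lebesgue" .
  show ?thesis by measurable
qed

lemma sets_interaction_domain:
  fixes \<Omega> :: "(real^'n) set"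
  assumes "open \<Omega>"
  shows "UNIV - (- \<Omega>) \<times> (- \<Omega>) \<in> sets lebesgue"
proof -
  have "open (UNIV - (- \<Omega>) \<times> (- \<Omega>))"
    using assms by (intro open_Diff closed_Times) (auto simp: closed_def)
  then show ?thesis by simp
qed

text \<open>Boundedness and bounded support give finite integrals against locally integrable
  weights, hence against both parts of \<open>V\<close>; the Gagliardo seminorm is controlled by
  that of \<open>u\<close> and by the cutoff kernel.\<close>

lemma log_test_mem_Y0_sp:
  fixes u :: "real^'n \<Rightarrow> real"
  assumes p: "1 < p" and s: "0 < s" "s < 1" and b: "0 < b" and r: "0 < r"
    and \<Omega>: "open \<Omega>" "bounded \<Omega>" and B: "ball x0 (3 * r / 2) \<subseteq> \<Omega>"
    and u: "u \<in> X_sp s p \<Omega>" and V: "V \<in> potentials s p q"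
  shows "log_test p b x0 r u \<in> Y0_sp s p V \<Omega>"
proof -
  let ?a = "real CARD('n) + p * s" and ?A = "UNIV - (- \<Omega>) \<times> (- \<Omega>)"
  define \<phi> where "\<phi> = log_test p b x0 r u"
  have um: "u \<in> borel_measurable lebesgue" using u by (simp add: X_sp_def)
  have \<phi>[measurable]: "\<phi> \<in> borel_measurable lebesgue"
    unfolding \<phi>_def by (rule log_test_measurable[OF um])
  have zero: "\<phi> x = 0" if "x \<notin> \<Omega>" for x
    unfolding \<phi>_def using that B by (intro log_test_eq_0 r) auto
  have bound: "\<bar>\<phi> x\<bar> powr p \<le> (b powr (1 - p)) powr p" for x
    using p b log_test_le[of p b x0 r u x] log_test_nonneg[of p b x0 r u x]
    unfolding \<phi>_def by (intro powr_mono2) auto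
  have Lp: "(\<integral>\<^sup>+x\<in>\<Omega>. ennreal (\<bar>\<phi> x\<bar> powr p) \<partial>lebesgue) < \<infinity>"
  proof -
    have "(\<integral>\<^sup>+x\<in>\<Omega>. ennreal (\<bar>\<phi> x\<bar> powr p) \<partial>lebesgue)
        \<le> (\<integral>\<^sup>+x. ennreal ((b powr (1 - p)) powr p) * indicator \<Omega> x \<partial>lebesgue)"
      by (intro nn_integral_mono mult_right_mono ennreal_leI bound) auto
    also have "\<dots> = ennreal ((b powr (1 - p)) powr p) * emeasure lebesgue \<Omega>"
      using \<Omega> by (intro nn_integral_cmult_indicator) simp
    also have "\<dots> < \<infinity>"
      using emeasure_bounded_finite[OF \<Omega>(2)] \<Omega> by (simp add: ennreal_mult_less_top)
    finally show ?thesis .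
  qed
  define C1 where "C1 = 2 powr p * ((p - 1) * b powr (- p)) powr p"
  define C2 where "C2 = 2 powr p * (b powr (1 - p) * p) powr p * 2 powr p"
  define gu where "gu z = \<bar>u (fst z) - u (snd z)\<bar> powr p / norm (fst z - snd z) powr ?a" for z
  define near where "near z = (indicator (ball x0 (3 * r / 2)) (fst z) + indicator (ball x0 (3 * r / 2)) (snd z))
      * cut_kernel p ?a r (fst z - snd z)" for z :: "(real^'n) \<times> (real^'n)"
  have near_int: "(\<integral>\<^sup>+z. ennreal (near z) \<partial>lebesgue) < \<infinity>"
    using le_less_trans[OF nn_integral_near_diagonal_le[of p s r "3 * r / 2" x0] ennreal_less_top] p s r
    by (simp add: near_def)
  have gum[measurable]: "gu \<in> borel_measurable lebesgue"
    unfolding gu_def by (rule gagliardo_integrand_measurable[OF um])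
  have gag: "gagliardo s p ?A \<phi> < \<infinity>"
  proof -
    have "gagliardo s p ?A \<phi> \<le> (\<integral>\<^sup>+z. ennreal C1 * (ennreal (gu z) * indicator ?A z) + ennreal C2 * ennreal (near z) \<partial>lebesgue)"
      unfolding gagliardo_def
    proof (rule nn_integral_mono)
      fix z :: "(real^'n) \<times> (real^'n)"
      let ?N = "norm (fst z - snd z) powr ?a"
      have "\<bar>\<phi> (fst z) - \<phi> (snd z)\<bar> powr p / ?N
        \<le> (C1 * \<bar>u (fst z) - u (snd z)\<bar> powr p + C2 * ((indicator (ball x0 (3 * r / 2)) (fst z) + indicator (ball x0 (3 * r / 2)) (snd z))
        * min 1 (norm (fst z - snd z) / r) powr p)) / ?N"
        using log_test_diff_powr_le[OF p b r, of x0 u "fst z" "snd z"]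
        unfolding \<phi>_def C1_def C2_def by (intro divide_right_mono) auto
      also have "\<dots> = C1 * gu z + C2 * near z"
        by (simp add: gu_def near_def cut_kernel_def add_divide_distrib)
      finally have "ennreal (\<bar>\<phi> (fst z) - \<phi> (snd z)\<bar> powr p / ?N) \<le> ennreal (C1 * gu z + C2 * near z)"
        by (rule ennreal_leI)
      also have "\<dots> = ennreal C1 * ennreal (gu z) + ennreal C2 * ennreal (near z)"
        by (rule ennreal_sum_of_products[symmetric])
          (auto simp: C1_def C2_def gu_def near_def cut_kernel_nonneg)
      finally show "ennreal (\<bar>\<phi> (fst z) - \<phi> (snd z)\<bar> powr p / ?N) * indicator ?A z
          \<le> ennreal C1 * (ennreal (gu z) * indicator ?A z) + ennreal C2 * ennreal (near z)"
        by (cases "z \<in> ?A") auto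
    qed
    also have "\<dots> = ennreal C1 * gagliardo s p ?A u + ennreal C2 * (\<integral>\<^sup>+z. ennreal (near z) \<partial>lebesgue)"
    proof -
      have [measurable]: "near \<in> borel_measurable lebesgue"
      proof -
        define B where "B = (ball x0 (3 * r / 2) :: (real^'n) set)"
        have [measurable]: "B \<in> sets lebesgue" by (simp add: B_def)
        have "cut_kernel p ?a r \<in> borel_measurable (lborel :: (real^'n) measure)" by measurable
        from measurable_compose[OF measurable_lebesgue_diff measurable_completion[OF this]]
        have [measurable]: "(\<lambda>z::(real^'n) \<times> (real^'n). cut_kernel p ?a r (fst z - snd z)) \<in> borel_measurable lebesgue" .
        show ?thesis unfolding near_def B_def[symmetric] by measurable
      qed
      have "(\<lambda>z. ennreal (gu z) * indicator ?A z) \<in> borel_measurable lebesgue"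
        using sets_interaction_domain[OF \<Omega>(1)] by measurable
      then show ?thesis
        unfolding gagliardo_def gu_def[symmetric] by (simp add: nn_integral_add nn_integral_cmult)
    qed
    also have "\<dots> < \<infinity>"
      using u near_int by (auto simp: X_sp_def ennreal_mult_less_top ennreal_add_less_top)
    finally show ?thesis .
  qed
  have LV: "(\<integral>\<^sup>+x\<in>\<Omega>. ennreal (\<bar>\<phi> x\<bar> powr p * W x) \<partial>lebesgue) < \<infinity>"
    if W: "W \<in> Lq_loc t" "1 \<le> t" for W t
  proof -
    \<comment> \<open>Local integrability is stated for compact sets. The closed ball may leave
      \<Omega>, which is harmless because the weight is locally integrable on the whole
      space.\<close>
    let ?C = "cball x0 (3 * r / 2)"
    have [measurable]: "W \<in> borel_measurable lebesgue" using W by (simp add: Lq_loc_def)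
    have "(\<integral>\<^sup>+x\<in>\<Omega>. ennreal (\<bar>\<phi> x\<bar> powr p * W x) \<partial>lebesgue)
        \<le> (\<integral>\<^sup>+x. ennreal ((b powr (1 - p)) powr p) * (ennreal \<bar>W x\<bar> * indicator ?C x) \<partial>lebesgue)"
    proof (rule nn_integral_mono)
      fix x
      show "ennreal (\<bar>\<phi> x\<bar> powr p * W x) * indicator \<Omega> x
          \<le> ennreal ((b powr (1 - p)) powr p) * (ennreal \<bar>W x\<bar> * indicator ?C x)"
      proof (cases "x \<in> ball x0 (3 * r / 2)")
        case True
        have "\<bar>\<phi> x\<bar> powr p * W x \<le> (b powr (1 - p)) powr p * \<bar>W x\<bar>"
          using mult_mono[OF bound[of x] abs_ge_self[of "W x"]]
          by (smt (verit) mult_left_mono bound mult_right_mono powr_ge_zero)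
        then have "ennreal (\<bar>\<phi> x\<bar> powr p * W x) \<le> ennreal ((b powr (1 - p)) powr p) * ennreal \<bar>W x\<bar>"
          by (simp add: ennreal_mult[symmetric] ennreal_leI)
        then show ?thesis using True by (cases "x \<in> \<Omega>") auto
      next
        case False
        then show ?thesis using log_test_eq_0[OF r False, of p b u] by (simp add: \<phi>_def)
      qed
    qed
    also have "\<dots> = ennreal ((b powr (1 - p)) powr p) * (\<integral>\<^sup>+x\<in>?C. ennreal \<bar>W x\<bar> \<partial>lebesgue)"
      by (intro nn_integral_cmult borel_measurable_times_ennreal borel_measurable_indicator) auto
    also have "\<dots> < \<infinity>"
      using Lq_loc_nn_integral_finite[OF W, of ?C] by (simp add: ennreal_mult_less_top)
    finally show ?thesis .
  qed
  have q: "1 \<le> q" "pos_part V \<in> Lq_loc q" "neg_part V \<in> Lq_loc 1"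
    using V by (auto simp: potentials_def)
  show ?thesis
    using Lp gag zero LV[OF q(2,1)] LV[OF q(3)] \<phi>
    unfolding \<phi>_def[symmetric] Y0_sp_def X0_sp_def X_sp_def L_V_def by auto
qed

section \<open>The two terms of the tested inequality\<close>

lemma H_measurable [measurable]: "H p \<in> borel_measurable borel"
  unfolding H_def by measurable

lemma abs_H: "1 < p \<Longrightarrow> \<bar>H p t\<bar> = \<bar>t\<bar> powr (p - 1)"
  by (cases "t = 0") (auto simp: H_def abs_mult powr_diff power2_eq_square)

text \<open>Young's inequality bounds the integrand by the sum of the two Gagliardo integrands.
  Those are integrable only away from pairs of exterior points, and there the increment of \<phi>
  vanishes.\<close>

lemma integrable_kernel_form:
  fixes u \<phi> :: "real^'n \<Rightarrow> real"
  assumes p: "1 < p" and K: "is_kernel s p lam Lam K" and k: "0 \<le> kernel_const CARD('n) p s * Lam"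
    and \<Omega>: "open \<Omega>" and u: "u \<in> X_sp s p \<Omega>" and \<phi>: "\<phi> \<in> X_sp s p \<Omega>"
    and zero: "\<And>x. x \<notin> \<Omega> \<Longrightarrow> \<phi> x = 0"
  shows "integrable (kernel_measure K) (\<lambda>z. H p (u (fst z) - u (snd z)) * (\<phi> (fst z) - \<phi> (snd z)))"
proof -
  let ?a = "real CARD('n) + p * s" and ?A = "UNIV - (- \<Omega>) \<times> (- \<Omega>)"
  let ?F = "\<lambda>z. H p (u (fst z) - u (snd z)) * (\<phi> (fst z) - \<phi> (snd z))"
  define q where "q v z = \<bar>v (fst z) - v (snd z)\<bar> powr p / norm (fst z - snd z) powr ?a"
    for v :: "real^'n \<Rightarrow> real" and z
  have um[measurable]: "u \<in> borel_measurable lebesgue" using u by (simp add: X_sp_def)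
  have pm[measurable]: "\<phi> \<in> borel_measurable lebesgue" using \<phi> by (simp add: X_sp_def)
  have A[measurable]: "?A \<in> sets lebesgue" by (rule sets_interaction_domain[OF \<Omega>])
  have qm[measurable]: "q u \<in> borel_measurable lebesgue" "q \<phi> \<in> borel_measurable lebesgue"
    unfolding q_def[abs_def] by (rule gagliardo_integrand_measurable, fact)+
  have F[measurable]: "?F \<in> borel_measurable lebesgue" by measurable
  have "(\<integral>\<^sup>+z. ennreal \<bar>?F z\<bar> \<partial>kernel_measure K)
      \<le> ennreal (kernel_const CARD('n) p s * Lam)
        * (\<integral>\<^sup>+z. ennreal (indicator ?A z * (q u z + q \<phi> z)) \<partial>lebesgue)"
  proof (rule nn_integral_kernel_measure_le[OF K])
    fix z :: "(real^'n) \<times> (real^'n)"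
    let ?N = "norm (fst z - snd z) powr ?a"
    show "\<bar>?F z\<bar> / ?N \<le> indicator ?A z * (q u z + q \<phi> z)"
    proof (cases "z \<in> ?A")
      case True
      have "\<bar>?F z\<bar> \<le> \<bar>u (fst z) - u (snd z)\<bar> powr p + \<bar>\<phi> (fst z) - \<phi> (snd z)\<bar> powr p"
        using p by (simp add: abs_mult abs_H powr_mult_le_add)
      then have "\<bar>?F z\<bar> / ?N \<le> (\<bar>u (fst z) - u (snd z)\<bar> powr p + \<bar>\<phi> (fst z) - \<phi> (snd z)\<bar> powr p) / ?N"
        by (intro divide_right_mono) auto
      then show ?thesis using True by (simp add: q_def add_divide_distrib)
    next
      case False
      then have "fst z \<notin> \<Omega>" "snd z \<notin> \<Omega>" by (auto simp: mem_Times_iff)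
      then show ?thesis using False by (simp add: zero)
    qed
  next
    show "(\<lambda>z. indicator ?A z * (q u z + q \<phi> z)) \<in> borel_measurable lebesgue"
      by (intro borel_measurable_times borel_measurable_add borel_measurable_indicator A qm)
  qed (use F k in auto)
  also have "(\<integral>\<^sup>+z. ennreal (indicator ?A z * (q u z + q \<phi> z)) \<partial>lebesgue)
      = (\<integral>\<^sup>+z. ennreal (q u z) * indicator ?A z + ennreal (q \<phi> z) * indicator ?A z \<partial>lebesgue)"
    by (intro nn_integral_cong) (auto simp: q_def indicator_def)
  also have "\<dots> = gagliardo s p ?A u + gagliardo s p ?A \<phi>"
    unfolding gagliardo_def q_def[symmetric]
    by (intro nn_integral_add borel_measurable_times_ennreal borel_measurable_indicator A
        measurable_compose[OF _ measurable_ennreal] qm)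
  also have "ennreal (kernel_const CARD('n) p s * Lam) * \<dots> < \<infinity>"
    using u \<phi> by (auto simp: X_sp_def ennreal_mult_less_top ennreal_add_less_top)
  finally show ?thesis
    using F by (intro integrableI_bounded) (auto cong: measurable_cong_sets[OF sets_kernel_measure refl])
qed

lemma integral_potential_term_le:
  fixes u V :: "real^'n \<Rightarrow> real"
  assumes p: "1 < p" and b: "0 < b" and r: "0 < r"
    and u0: "AE x in lebesgue. x \<in> ball x0 (3 * r / 2) \<longrightarrow> 0 \<le> u x"
    and V: "V \<in> potentials s p q"
  defines "v \<equiv> \<integral>\<^sup>+x\<in>ball x0 (3 * r / 2). ennreal \<bar>pos_part V x\<bar> \<partial>lebesgue"
  shows "ennreal (\<integral>x. V x * \<bar>u x\<bar> powr (p - 2) * u x * log_test p b x0 r u x \<partial>lebesgue) \<le> v"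
    and "v < \<infinity>"
proof -
  let ?B = "ball x0 (3 * r / 2)"
  let ?g = "\<lambda>x. V x * \<bar>u x\<bar> powr (p - 2) * u x * log_test p b x0 r u x"
  let ?h = "\<lambda>x. indicator ?B x * pos_part V x"
  have q: "1 \<le> q" "pos_part V \<in> Lq_loc q" using V by (auto simp: potentials_def)
  then have Vm: "pos_part V \<in> borel_measurable lebesgue" by (simp add: Lq_loc_def)
  have V0: "0 \<le> pos_part V x" for x by (simp add: pos_part_def)
  have hm: "?h \<in> borel_measurable lebesgue"
    by (intro borel_measurable_times borel_measurable_indicator Vm) simp
  have vh: "v = (\<integral>\<^sup>+x. ennreal (?h x) \<partial>lebesgue)"
    unfolding v_def by (intro nn_integral_cong) (auto simp: indicator_def V0)
  have "v \<le> (\<integral>\<^sup>+x\<in>cball x0 (3 * r / 2). ennreal \<bar>pos_part V x\<bar> \<partial>lebesgue)"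
    unfolding v_def by (intro nn_integral_mono) (auto simp: indicator_def)
  also have "\<dots> < \<infinity>" by (rule Lq_loc_nn_integral_finite[OF q(2,1)]) simp
  finally show fin: "v < \<infinity>" .
  have h: "integrable lebesgue ?h"
    using hm fin V0 unfolding vh by (intro integrableI_bounded) (auto simp: abs_mult)
  have le: "AE x in lebesgue. ?g x \<le> ?h x"
    using u0
  proof eventually_elim
    fix x assume ux: "x \<in> ?B \<longrightarrow> 0 \<le> u x"
    show "?g x \<le> ?h x"
    proof (cases "x \<in> ?B")
      case True
      let ?w = "\<bar>u x\<bar> powr (p - 2) * u x * log_test p b x0 r u x"
      have u: "0 \<le> u x" using True ux by simp
      then have e: "\<bar>u x\<bar> powr (p - 2) * u x = u x powr (p - 1)"
        using H_nonneg_eq[of "u x" p] by (simp add: H_def)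
      have "?w \<le> (u x + b) powr (p - 1) * (1 * (u x + b) powr (1 - p))"
      proof -
        have "cutoff x0 r x powr p \<le> 1" using cutoff_bounds[of x0 r x] p by (intro powr_le1) auto
        moreover have "u x powr (p - 1) \<le> (u x + b) powr (p - 1)"
          using u b p by (intro powr_mono2) auto
        moreover have "max (u x) 0 = u x" using u by simp
        ultimately show ?thesis
          unfolding e log_test_def by (simp only:) (intro mult_mono order_refl; simp)
      qed
      also have "\<dots> = 1" using u b by (simp flip: powr_add)
      finally have w1: "?w \<le> 1" .
      have w0: "0 \<le> ?w" using u by (simp add: log_test_nonneg)
      have "?g x = V x * ?w" by (simp add: mult_ac)
      also have "\<dots> \<le> pos_part V x * ?w" using w0 by (intro mult_right_mono) (auto simp: pos_part_def)
      also have "\<dots> \<le> pos_part V x" using w1 V0 by (intro mult_left_le)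
      finally show ?thesis using True by simp
    next
      case False
      then show ?thesis using log_test_eq_0[OF r False, of p b u] by simp
    qed
  qed
  have "(\<integral>x. ?g x \<partial>lebesgue) \<le> (\<integral>x. ?h x \<partial>lebesgue)"
  proof (cases "integrable lebesgue ?g")
    case True then show ?thesis using h le by (intro integral_mono_AE)
  next
    \<comment> \<open>The Bochner integral of a non-integrable function is 0, which still lies below
      the nonnegative right-hand side.\<close>
    case False
    then show ?thesis using V0 by (simp add: not_integrable_integral_eq integral_nonneg)
  qed
  then have "ennreal (\<integral>x. ?g x \<partial>lebesgue) \<le> ennreal (\<integral>x. ?h x \<partial>lebesgue)" by (rule ennreal_leI)
  also have "\<dots> = v" unfolding vh using h V0 by (intro nn_integral_eq_integral[symmetric]) auto
  finally show "ennreal (\<integral>x. ?g x \<partial>lebesgue) \<le> v" .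
qed

text \<open>The estimate with explicit constants, before scaling. The pointwise majorant
  \<open>G\<close> contains no singular factor, so it is integrated against
  \<open>kernel_measure K\<close> first and converted to Lebesgue integrals by the upper bound on
  \<open>K\<close> afterwards.\<close>

lemma log_integral_le:
  fixes u V K :: "real^'n \<Rightarrow> real" and x0 :: "real^'n"
  assumes p: "1 < p" and s: "0 < s" "s < 1" and b: "0 < b" and r: "0 < r" and R: "2 * r < R"
    and \<Omega>: "open \<Omega>" "bounded \<Omega>" and ball: "ball x0 R \<subseteq> \<Omega>" and Lam: "0 \<le> Lam"
    and K: "is_kernel s p lam Lam K" and V: "V \<in> potentials s p q"
    and u: "weak_supersolution s p K V \<Omega> g u"
    and u0: "AE x in lebesgue. x \<in> ball x0 R \<longrightarrow> 0 \<le> u x"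
  defines "n \<equiv> real CARD('n)"
  defines "vol \<equiv> unit_ball_vol n * (3 * r / 2) ^ CARD('n)"
  shows "ennreal ((p - 1)\<^sup>2 / (2 * p)) * (\<integral>\<^sup>+z\<in>ball x0 r \<times> ball x0 r.
          ennreal (\<bar>ln ((u (fst z) + b) / (u (snd z) + b))\<bar> powr p) \<partial>kernel_measure K)
    \<le> ennreal (kernel_const CARD('n) p s * Lam) *
        (ennreal (4 powr p * (2 * vol * (cut_kernel_const CARD('n) p s * r powr (- (p * s)))))
         + ennreal (2 * (2 powr (p - 1) * b powr (1 - p)) * 4 powr (n + p * s) * vol) *
           (\<integral>\<^sup>+y\<in>- ball x0 R. ennreal (\<bar>neg_part u y\<bar> powr (p - 1) / norm (y - x0) powr (n + p * s)) \<partial>lebesgue))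
      + (\<integral>\<^sup>+x\<in>ball x0 (3 * r / 2). ennreal \<bar>pos_part V x\<bar> \<partial>lebesgue)"
proof -
  define B where "B = ball x0 (3 * r / 2)"
  define a where "a = n + p * s"
  define \<kappa> where "\<kappa> = kernel_const CARD('n) p s * Lam"
  define \<phi> where "\<phi> = log_test p b x0 r u"
  define N where "N y = neg_part u y powr (p - 1)" for y
  define W where "W y = 4 powr a * (indicator (- ball x0 R) y * (N y / norm (y - x0) powr a))" for y
  define T where "T = (\<integral>\<^sup>+y\<in>- ball x0 R. ennreal (N y / norm (y - x0) powr a) \<partial>lebesgue)"
  define c where "c = 2 powr (p - 1) * b powr (1 - p)"
  define \<delta> where "\<delta> = (p - 1)\<^sup>2 / (2 * p)"
  define v where "v = (\<integral>\<^sup>+x\<in>B. ennreal \<bar>pos_part V x\<bar> \<partial>lebesgue)"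
  define F where "F z = H p (u (fst z) - u (snd z)) * (\<phi> (fst z) - \<phi> (snd z))" for z
  define L where "L z = indicator (ball x0 r \<times> ball x0 r) z * \<bar>ln ((u (fst z) + b) / (u (snd z) + b))\<bar> powr p" for z
  define G where "G z = 4 powr p * ((indicator B (fst z) + indicator B (snd z)) * min 1 (norm (fst z - snd z) / r) powr p)
       + c * (indicator B (fst z) * (indicator (- ball x0 R) (snd z) * N (snd z))
            + indicator B (snd z) * (indicator (- ball x0 R) (fst z) * N (fst z)))" for z :: "(real^'n) \<times> (real^'n)"
  define near where "near z = (indicator B (fst z) + indicator B (snd z)) * cut_kernel p a r (fst z - snd z)" for z
  define g1 where "g1 z = indicator B (fst z) * W (snd z)" for z
  define g2 where "g2 z = indicator B (snd z) * W (fst z)" for z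
  have a0: "0 \<le> a" using p s by (simp add: a_def n_def)
  have k0: "0 \<le> \<kappa>" using kernel_const_pos[of p s "CARD('n)"] p s Lam by (simp add: \<kappa>_def)
  have d0: "0 \<le> \<delta>" using p by (simp add: \<delta>_def)
  have c0: "0 \<le> c" by (simp add: c_def)
  have vol0: "0 \<le> vol" using r by (simp add: vol_def n_def)
  have N0: "0 \<le> N y" for y by (simp add: N_def)
  have W0: "0 \<le> W y" for y by (simp add: W_def N0)
  have Y: "u \<in> X_sp s p \<Omega>" using u by (simp add: weak_supersolution_def Yg_plus_def Y_sp_def)
  then have um[measurable]: "u \<in> borel_measurable lebesgue" by (simp add: X_sp_def)
  have Bm[measurable]: "B \<in> sets lebesgue" by (simp add: B_def)
  have BR: "B \<subseteq> ball x0 R" using r R by (auto simp: B_def)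
  then have B\<Omega>: "B \<subseteq> \<Omega>" using ball by blast
  have Nm[measurable]: "N \<in> borel_measurable lebesgue"
    unfolding N_def[abs_def] neg_part_def by measurable
  have Cm: "- ball x0 R \<in> sets lebesgue" by simp
  define C where "C = - ball x0 R"
  have [measurable]: "C \<in> sets lebesgue" unfolding C_def by (rule Cm)
  have "(\<lambda>y. norm (y - x0) powr a) \<in> borel_measurable lborel" by measurable
  from measurable_completion[OF this] have [measurable]: "(\<lambda>y. norm (y - x0) powr a) \<in> borel_measurable lebesgue" .
  have Wm[measurable]: "W \<in> borel_measurable lebesgue"
    unfolding W_def[abs_def] C_def[symmetric] by measurable
  have "(\<lambda>z::real^'n. min 1 (norm z / r) powr p) \<in> borel_measurable lborel" by measurable
  from measurable_compose[OF measurable_lebesgue_diff measurable_completion[OF this]]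
  have [measurable]: "(\<lambda>z::(real^'n) \<times> (real^'n). min 1 (norm (fst z - snd z) / r) powr p) \<in> borel_measurable lebesgue" .
  have Gm[measurable]: "G \<in> borel_measurable lebesgue"
    unfolding G_def[abs_def] C_def[symmetric] by measurable
  have "cut_kernel p a r \<in> borel_measurable (lborel :: (real^'n) measure)" by measurable
  from measurable_compose[OF measurable_lebesgue_diff measurable_completion[OF this]]
  have [measurable]: "(\<lambda>z::(real^'n) \<times> (real^'n). cut_kernel p a r (fst z - snd z)) \<in> borel_measurable lebesgue" .
  have [measurable]: "near \<in> borel_measurable lebesgue" "g1 \<in> borel_measurable lebesgue" "g2 \<in> borel_measurable lebesgue"
    unfolding near_def[abs_def] g1_def[abs_def] g2_def[abs_def] by measurable
  have G0: "0 \<le> G z" for z using c0 N0 by (simp add: G_def)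
  have L0: "0 \<le> L z" for z by (simp add: L_def)
  have phi_mem: "\<phi> \<in> Y0_sp s p V \<Omega>"
    unfolding \<phi>_def using B\<Omega> by (intro log_test_mem_Y0_sp[OF p s b r \<Omega> _ Y V]) (simp add: B_def)
  then have phi_X: "\<phi> \<in> X_sp s p \<Omega>" by (simp add: Y0_sp_def X0_sp_def)
  have phi_zero: "\<phi> x = 0" if "x \<notin> \<Omega>" for x
    unfolding \<phi>_def using that B\<Omega> by (intro log_test_eq_0 r) (auto simp: B_def)
  have intF: "integrable (kernel_measure K) F"
    unfolding F_def[abs_def] using k0 unfolding \<kappa>_def
    by (intro integrable_kernel_form[OF p K _ \<Omega>(1) Y phi_X phi_zero])
  have u0B: "AE x in lebesgue. x \<in> ball x0 (3 * r / 2) \<longrightarrow> 0 \<le> u x"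
    using u0 BR unfolding B_def by (auto elim!: eventually_mono)
  let ?P = "\<integral>x. V x * \<bar>u x\<bar> powr (p - 2) * u x * \<phi> x \<partial>lebesgue"
  have v: "ennreal ?P \<le> v" "v < \<infinity>"
    using integral_potential_term_le[OF p b r u0B V] by (simp_all add: v_def B_def \<phi>_def)
  then obtain w where w: "0 \<le> w" "v = ennreal w" by (cases v) auto
  \<comment> \<open>Valid for either sign of \<open>?P\<close>: negative numbers are mapped to 0 by
    \<open>ennreal\<close>, and \<open>w\<close> is nonnegative.\<close>
  have "?P \<le> w" using v w by (simp add: ennreal_le_iff)
  moreover have "0 \<le> (\<integral>z. F z \<partial>kernel_measure K) + ?P"
    using u phi_mem log_test_nonneg[of p b x0 r u]
    unfolding weak_supersolution_def F_def \<phi>_def by blast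
  ultimately have Fw: "- w \<le> (\<integral>z. F z \<partial>kernel_measure K)" by simp
  have AE: "AE z in kernel_measure K. F z + \<delta> * L z \<le> G z"
  proof -
    \<comment> \<open>The exceptional set of \<open>u\<close> is null in each coordinate separately,
      hence null in the product; a measure with a density inherits this.\<close>
    have "AE z in (lebesgue :: ((real^'n) \<times> (real^'n)) measure). F z + \<delta> * L z \<le> G z"
      using AE_lebesgue_fst[OF u0] AE_lebesgue_snd[OF u0]
    proof eventually_elim
      fix z :: "(real^'n) \<times> (real^'n)"
      assume "fst z \<in> ball x0 R \<longrightarrow> 0 \<le> u (fst z)" "snd z \<in> ball x0 R \<longrightarrow> 0 \<le> u (snd z)"
      then show "F z + \<delta> * L z \<le> G z"
        using log_test_pointwise[OF p b r R, of "fst z" x0 u "snd z"]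
        by (simp add: F_def L_def G_def \<delta>_def \<phi>_def B_def c_def N_def)
    qed
    then show ?thesis
      unfolding kernel_measure_def
      by (subst AE_density[OF kernel_density_measurable[OF is_kernelD(1)[OF K]]]) (auto elim!: eventually_mono)
  qed
  have "ennreal \<delta> * (\<integral>\<^sup>+z\<in>ball x0 r \<times> ball x0 r.
          ennreal (\<bar>ln ((u (fst z) + b) / (u (snd z) + b))\<bar> powr p) \<partial>kernel_measure K)
      = (\<integral>\<^sup>+z. ennreal (\<delta> * L z) \<partial>kernel_measure K)"
  proof -
    have "ball x0 r \<times> ball x0 r \<in> sets lebesgue" by (simp add: open_Times)
    then have "(\<lambda>z. ennreal (\<bar>ln ((u (fst z) + b) / (u (snd z) + b))\<bar> powr p) * indicator (ball x0 r \<times> ball x0 r) z)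
        \<in> borel_measurable lebesgue"
      by (intro borel_measurable_times_ennreal borel_measurable_indicator) measurable
    then have "ennreal \<delta> * (\<integral>\<^sup>+z\<in>ball x0 r \<times> ball x0 r.
          ennreal (\<bar>ln ((u (fst z) + b) / (u (snd z) + b))\<bar> powr p) \<partial>kernel_measure K)
      = (\<integral>\<^sup>+z. ennreal \<delta> * (ennreal (\<bar>ln ((u (fst z) + b) / (u (snd z) + b))\<bar> powr p) * indicator (ball x0 r \<times> ball x0 r) z) \<partial>kernel_measure K)"
      by (intro nn_integral_cmult[symmetric]) (simp cong: measurable_cong_sets[OF sets_kernel_measure refl])
    also have "\<dots> = (\<integral>\<^sup>+z. ennreal (\<delta> * L z) \<partial>kernel_measure K)"
      using d0 by (intro nn_integral_cong) (simp add: L_def ennreal_mult split: split_indicator)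
    finally show ?thesis .
  qed
  also have "\<dots> \<le> (\<integral>\<^sup>+z. ennreal (G z) \<partial>kernel_measure K) + v"
    unfolding w(2) using intF AE d0 L0 G0 Fw w
    by (intro nn_integral_absorb) (auto cong: measurable_cong_sets[OF sets_kernel_measure refl])
  finally have absorb: "ennreal \<delta> * (\<integral>\<^sup>+z\<in>ball x0 r \<times> ball x0 r.
          ennreal (\<bar>ln ((u (fst z) + b) / (u (snd z) + b))\<bar> powr p) \<partial>kernel_measure K)
      \<le> (\<integral>\<^sup>+z. ennreal (G z) \<partial>kernel_measure K) + v" .
  have G_le: "(\<integral>\<^sup>+z. ennreal (G z) \<partial>kernel_measure K)
      \<le> ennreal \<kappa> * (\<integral>\<^sup>+z. ennreal (4 powr p * near z + c * (g1 z + g2 z)) \<partial>lebesgue)"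
    unfolding \<kappa>_def
  proof (rule nn_integral_kernel_measure_le[OF K Gm G0])
    \<comment> \<open>The increment vanishes for equal points, and no point lies both in
      \<open>B\<close> and outside the ball of radius \<open>R\<close>.\<close>
    show "G (x, x) = 0" for x
      using p BR by (auto simp: G_def indicator_def)
    show "(\<lambda>z. 4 powr p * near z + c * (g1 z + g2 z)) \<in> borel_measurable lebesgue" by measurable
    show "0 \<le> kernel_const CARD('n) p s * Lam" using k0 by (simp add: \<kappa>_def)
    fix z :: "(real^'n) \<times> (real^'n)"
    let ?N = "norm (fst z - snd z) powr a"
    have far: "indicator B x * (indicator (- ball x0 R) y * N y) / norm (x - y) powr a \<le> indicator B x * W y" for x y
      using nn_integral_far_le(3)[OF Nm N0 a0 r R, of x x0 y] W0[of y]
      by (cases "x \<in> B"; cases "y \<in> ball x0 R") (auto simp: B_def W_def)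
    have "G z / ?N = 4 powr p * near z
        + c * (indicator B (fst z) * (indicator (- ball x0 R) (snd z) * N (snd z)) / ?N
            + indicator B (snd z) * (indicator (- ball x0 R) (fst z) * N (fst z)) / ?N)"
      by (simp add: G_def near_def cut_kernel_def add_divide_distrib distrib_left)
    also have "\<dots> \<le> 4 powr p * near z + c * (g1 z + g2 z)"
      using far[of "fst z" "snd z"] far[of "snd z" "fst z"] c0
      by (intro add_left_mono mult_left_mono add_mono) (auto simp: g1_def g2_def norm_minus_commute)
    finally show "G z / norm (fst z - snd z) powr (real CARD('n) + p * s) \<le> 4 powr p * near z + c * (g1 z + g2 z)"
      by (simp add: a_def n_def)
  qed
  have "(\<integral>\<^sup>+z. ennreal (4 powr p * near z + c * (g1 z + g2 z)) \<partial>lebesgue)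
      = ennreal (4 powr p) * (\<integral>\<^sup>+z. ennreal (near z) \<partial>lebesgue)
        + ennreal c * ((\<integral>\<^sup>+z. ennreal (g1 z) \<partial>lebesgue) + (\<integral>\<^sup>+z. ennreal (g2 z) \<partial>lebesgue))"
  proof -
    have "ennreal (4 powr p * near z + c * (g1 z + g2 z))
        = ennreal (4 powr p) * ennreal (near z) + ennreal c * (ennreal (g1 z) + ennreal (g2 z))" for z
    proof -
      have "0 \<le> near z" "0 \<le> g1 z" "0 \<le> g2 z"
        by (auto simp: near_def g1_def g2_def cut_kernel_nonneg W0)
      then show ?thesis using c0 by (simp add: ennreal_mult ennreal_plus)
    qed
    then show ?thesis by (simp add: nn_integral_add nn_integral_cmult)
  qed
  also have "\<dots> \<le> ennreal (4 powr p * (2 * vol * (cut_kernel_const CARD('n) p s * r powr (- (p * s)))))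
      + ennreal (2 * c * 4 powr a * vol) * T"
  proof (rule add_mono)
    have "(\<integral>\<^sup>+z. ennreal (near z) \<partial>lebesgue) \<le> ennreal (2 * vol * (cut_kernel_const CARD('n) p s * r powr (- (p * s))))"
      using nn_integral_near_diagonal_le[of p s r "3 * r / 2" x0] p s r
      by (simp add: near_def[abs_def] B_def a_def n_def vol_def)
    then have "ennreal (4 powr p) * (\<integral>\<^sup>+z. ennreal (near z) \<partial>lebesgue)
        \<le> ennreal (4 powr p) * ennreal (2 * vol * (cut_kernel_const CARD('n) p s * r powr (- (p * s))))"
      by (rule mult_left_mono) simp
    also have "\<dots> = ennreal (4 powr p * (2 * vol * (cut_kernel_const CARD('n) p s * r powr (- (p * s)))))"
      by (rule ennreal_mult'[symmetric]) simp
    finally show "ennreal (4 powr p) * (\<integral>\<^sup>+z. ennreal (near z) \<partial>lebesgue)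
      \<le> ennreal (4 powr p * (2 * vol * (cut_kernel_const CARD('n) p s * r powr (- (p * s)))))" .
    have eB: "emeasure lebesgue B = ennreal vol"
      using r by (simp add: B_def vol_def n_def emeasure_ball)
    \<comment> \<open>The two orders of a near and a far point contribute equally, hence the factor
      2 in the tail coefficient.\<close>
    have "(\<integral>\<^sup>+z. ennreal (g1 z) \<partial>lebesgue) = ennreal (4 powr a) * ennreal vol * T"
      "(\<integral>\<^sup>+z. ennreal (g2 z) \<partial>lebesgue) = ennreal (4 powr a) * ennreal vol * T"
      using nn_integral_far_le(1,2)[OF Nm N0 a0 r R, of x0] unfolding g1_def g2_def W_def T_def B_def eB[unfolded B_def] .
    then have "ennreal c * ((\<integral>\<^sup>+z. ennreal (g1 z) \<partial>lebesgue) + (\<integral>\<^sup>+z. ennreal (g2 z) \<partial>lebesgue))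
      = ennreal c * (2 * (ennreal (4 powr a) * ennreal vol * T))"
      by (simp only: mult_2)
    also have "\<dots> = ennreal (2 * c * 4 powr a * vol) * T"
    proof -
      have "ennreal (2 * c * 4 powr a * vol) = ennreal 2 * ennreal c * ennreal (4 powr a) * ennreal vol"
        using c0 vol0 by (simp only: ennreal_mult mult_nonneg_nonneg powr_ge_zero zero_le_numeral)
      then show ?thesis by (simp add: mult_ac)
    qed
    finally show "ennreal c * ((\<integral>\<^sup>+z. ennreal (g1 z) \<partial>lebesgue) + (\<integral>\<^sup>+z. ennreal (g2 z) \<partial>lebesgue))
      \<le> ennreal (2 * c * 4 powr a * vol) * T" by simp
  qed
  finally have "(\<integral>\<^sup>+z. ennreal (G z) \<partial>kernel_measure K)
      \<le> ennreal \<kappa> * (ennreal (4 powr p * (2 * vol * (cut_kernel_const CARD('n) p s * r powr (- (p * s)))))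
      + ennreal (2 * c * 4 powr a * vol) * T)"
    by (intro order_trans[OF G_le] mult_left_mono) auto
  then have "ennreal \<delta> * (\<integral>\<^sup>+z\<in>ball x0 r \<times> ball x0 r.
          ennreal (\<bar>ln ((u (fst z) + b) / (u (snd z) + b))\<bar> powr p) \<partial>kernel_measure K)
    \<le> ennreal \<kappa> * (ennreal (4 powr p * (2 * vol * (cut_kernel_const CARD('n) p s * r powr (- (p * s)))))
      + ennreal (2 * c * 4 powr a * vol) * T) + v"
    by (intro order_trans[OF absorb] add_right_mono)
  moreover have "T = (\<integral>\<^sup>+y\<in>- ball x0 R. ennreal (\<bar>neg_part u y\<bar> powr (p - 1) / norm (y - x0) powr (n + p * s)) \<partial>lebesgue)"
    by (simp add: T_def N_def a_def neg_part_def)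
  ultimately show ?thesis
    unfolding \<delta>_def \<kappa>_def c_def a_def v_def B_def by simp
qed

section \<open>Scaling and the choice of the constant\<close>

lemma epowr_inverse:
  assumes "0 < c"
  shows "epowr (epowr X (1 / c)) c = X"
  using assms by (cases X) (simp_all add: epowr_def powr_powr)

theorem theorem1p2:
  fixes \<Omega> :: "(real^'n) set" and s p lam Lam :: real
  assumes "bounded_lipschitz_domain \<Omega>"
    and "1 < p" and "0 < s" and "s < 1"
    and "0 < lam" and "lam \<le> Lam"
    and "real CARD('n) / (p * s) > 1"
  shows "\<exists>c0 > 0. \<forall>q K V g u x0 R.
    q > real CARD('n) / (p * s) \<longrightarrow>
    is_kernel s p lam Lam K \<longrightarrow>
    V \<in> potentials s p q \<longrightarrow>
    g \<in> W_sp s p \<longrightarrow>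
    weak_supersolution s p K V \<Omega> g u \<longrightarrow>
    ball x0 R \<subseteq> \<Omega> \<longrightarrow>
    (AE x in lebesgue. x \<in> ball x0 R \<longrightarrow> 0 \<le> u x) \<longrightarrow>
    (\<forall>b r. 0 < b \<longrightarrow> b < 1 \<longrightarrow> 0 < r \<longrightarrow> r < R / 2 \<longrightarrow>
      (\<integral>\<^sup>+z\<in>ball x0 r \<times> ball x0 r.
          ennreal (\<bar>ln ((u (fst z) + b) / (u (snd z) + b))\<bar> powr p) \<partial>kernel_measure K)
      \<le> ennreal (c0 * r powr (real CARD('n) - p * s)) *
          (ennreal (1 / b powr (p - 1) * (r / R) powr (p * s)) *
             epowr (tail s p R (neg_part u) x0) (p - 1)
           + (1 + Lq_norm q \<Omega> (pos_part V))))"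
proof -
  note p = assms(2) and s = assms(3,4)
  have \<Omega>: "open \<Omega>" "bounded \<Omega>" using assms(1) by (auto simp: bounded_lipschitz_domain_def)
  have ps: "0 < p * s" using p s by simp
  define n where "n = real CARD('n)"
  define \<kappa> where "\<kappa> = kernel_const CARD('n) p s * Lam"
  define \<beta> where "\<beta> = unit_ball_vol n * (3 / 2) ^ CARD('n)"
  define S where "S = surface_measure (sphere (0 :: real^'n) 1)"
  define C where "C = cut_kernel_const CARD('n) p s"
  define \<delta> where "\<delta> = (p - 1)\<^sup>2 / (2 * p)"
  \<comment> \<open>The three summands belong to the cutoff, the tail and the potential; \<delta> is
    the coefficient of the logarithm, and \<beta> is the volume of a ball of radius 3/2. The factor
    \<open>S / (p * s)\<close> in \<open>c2\<close> undoes the normalisation of the tail.\<close>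
  define c1 where "c1 = \<kappa> * (4 powr p * (2 * \<beta> * C))"
  define c2 where "c2 = \<kappa> * (2 * 2 powr (p - 1) * 4 powr (n + p * s) * \<beta>) * (S / (p * s))"
  define c3 where "c3 = (\<beta> + 1) * max 1 (diameter \<Omega>) powr (p * s)"
  define c0 where "c0 = (c1 + c2 + c3) / \<delta>"
  have Lam: "0 \<le> Lam" using assms(5,6) by simp
  have k0: "0 \<le> \<kappa>" using kernel_const_pos[of p s "CARD('n)"] p s Lam by (simp add: \<kappa>_def)
  have S: "0 < S" unfolding S_def by (rule surface_measure_sphere_pos)
  have b0: "0 \<le> \<beta>" by (simp add: \<beta>_def n_def)
  have C0: "0 \<le> C"
    using p s unfolding C_def cut_kernel_const_def
    by (intro mult_nonneg_nonneg add_nonneg_nonneg divide_nonneg_nonneg) auto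
  have d0: "0 < \<delta>" using p by (simp add: \<delta>_def)
  have c: "0 \<le> c1" "0 \<le> c2" "0 < c3"
    using k0 b0 C0 S ps by (auto simp: c1_def c2_def c3_def intro!: mult_pos_pos add_nonneg_pos)
  have c0: "0 < c0" using c d0 by (simp add: c0_def)
  show ?thesis
  proof (intro exI[of _ c0] conjI c0 allI impI)
    fix q K V g u and x0 :: "real^'n" and R b r :: real
    assume q: "q > real CARD('n) / (p * s)" and K: "is_kernel s p lam Lam K"
      and V: "V \<in> potentials s p q" and "g \<in> W_sp s p"
      and u: "weak_supersolution s p K V \<Omega> g u" and ball: "ball x0 R \<subseteq> \<Omega>"
      and u0: "AE x in lebesgue. x \<in> ball x0 R \<longrightarrow> 0 \<le> u x"
      and b: "0 < b" "b < 1" and r: "0 < r" "r < R / 2"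
    define I where "I = (\<integral>\<^sup>+z\<in>ball x0 r \<times> ball x0 r.
          ennreal (\<bar>ln ((u (fst z) + b) / (u (snd z) + b))\<bar> powr p) \<partial>kernel_measure K)"
    define \<rho> where "\<rho> = r powr (n - p * s)"
    define T where "T = (\<integral>\<^sup>+y\<in>- ball x0 R. ennreal (\<bar>neg_part u y\<bar> powr (p - 1) / norm (y - x0) powr (n + p * s)) \<partial>lebesgue)"
    define Y where "Y = ennreal (1 / b powr (p - 1) * (r / R) powr (p * s)) * epowr (tail s p R (neg_part u) x0) (p - 1)"
    define Z where "Z = 1 + Lq_norm q \<Omega> (pos_part V)"
    define vol where "vol = unit_ball_vol n * (3 * r / 2) ^ CARD('n)"
    have R: "2 * r < R" "0 < R" using r by auto
    have rho: "0 < \<rho>" using r by (simp add: \<rho>_def)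
    have vol: "vol = \<beta> * r powr n"
      using r by (simp add: vol_def \<beta>_def n_def powr_realpow power_mult_distrib power_divide)
    have Vint: "(\<integral>\<^sup>+x\<in>ball x0 (3 * r / 2). ennreal \<bar>pos_part V x\<bar> \<partial>lebesgue) \<le> ennreal (c3 * \<rho>) * Z"
    proof -
      have q1: "1 \<le> q" "pos_part V \<in> borel_measurable lebesgue"
        using q assms(7) V by (auto simp: potentials_def Lq_loc_def)
      have "real CARD('n) / q < p * s" using q q1 ps by (simp add: field_simps)
      \<comment> \<open>Through this bound \<Omega> enters the constant.\<close>
      moreover have "r \<le> diameter \<Omega>"
        using diameter_subset[OF ball \<Omega>(2)] R r by (simp add: diameter_ball)
      moreover have "ball x0 (3 / 2 * r) \<subseteq> \<Omega>" using ball R r by (force simp: subset_iff)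
      ultimately show ?thesis
        using nn_integral_ball_le_Lq_norm[OF q1(2,1) ps, of r "diameter \<Omega>" "3 / 2" x0 \<Omega>] \<Omega> r
        by (simp add: c3_def \<beta>_def \<rho>_def Z_def n_def)
    qed
    have tail: "epowr (tail s p R (neg_part u) x0) (p - 1) = ennreal (p * s / S * R powr (p * s)) * T"
      unfolding tail_def T_def S_def n_def using p by (intro epowr_inverse) simp
    have near: "\<kappa> * (4 powr p * (2 * vol * (C * r powr (- (p * s))))) = c1 * \<rho>"
      by (simp add: vol c1_def \<rho>_def powr_diff powr_minus field_simps)
    have far: "ennreal (\<kappa> * (2 * (2 powr (p - 1) * b powr (1 - p)) * 4 powr (n + p * s) * vol)) * T = ennreal (c2 * \<rho>) * Y"
    proof -
      have "\<kappa> * (2 * (2 powr (p - 1) * b powr (1 - p)) * 4 powr (n + p * s) * vol)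
          = c2 * \<rho> * (1 / b powr (p - 1) * (r / R) powr (p * s) * (p * s / S * R powr (p * s)))"
      proof -
        have e: "b powr (1 - p) = 1 / b powr (p - 1)" using powr_minus_divide[of b "p - 1"] by simp
        \<comment> \<open>The power of \<open>R\<close> in the normalisation of the tail cancels the
          denominator of \<open>(r / R) powr (p * s)\<close>, and the remaining power of
          \<open>r\<close> restores the ball volume.\<close>
        have e1: "\<rho> * (r / R) powr (p * s) * R powr (p * s) = r powr n"
          using r R by (simp add: \<rho>_def powr_divide powr_diff)
        have e2: "S / (p * s) * (p * s / S) = 1" using S p s by simp
        have "c2 * \<rho> * (1 / b powr (p - 1) * (r / R) powr (p * s) * (p * s / S * R powr (p * s)))
          = \<kappa> * (2 * 2 powr (p - 1) * 4 powr (n + p * s) * \<beta>) * b powr (1 - p)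
             * (S / (p * s) * (p * s / S)) * (\<rho> * (r / R) powr (p * s) * R powr (p * s))"
          unfolding c2_def e by (simp only: mult_ac)
        also have "\<dots> = \<kappa> * (2 * (2 powr (p - 1) * b powr (1 - p)) * 4 powr (n + p * s) * vol)"
          unfolding e1 e2 vol by simp
        finally show ?thesis ..
      qed
      also have "ennreal \<dots> = ennreal (c2 * \<rho>) * (ennreal (1 / b powr (p - 1) * (r / R) powr (p * s)) * ennreal (p * s / S * R powr (p * s)))"
        using c rho S ps by (simp only: ennreal_mult mult_nonneg_nonneg less_imp_le divide_nonneg_nonneg powr_ge_zero zero_le_one)
      finally show ?thesis unfolding Y_def tail by (simp only: mult.assoc)
    qed
    have "ennreal \<delta> * I \<le> ennreal \<kappa> *
        (ennreal (4 powr p * (2 * vol * (C * r powr (- (p * s)))))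
         + ennreal (2 * (2 powr (p - 1) * b powr (1 - p)) * 4 powr (n + p * s) * vol) * T)
      + (\<integral>\<^sup>+x\<in>ball x0 (3 * r / 2). ennreal \<bar>pos_part V x\<bar> \<partial>lebesgue)"
      using log_integral_le[OF p s b(1) r(1) R(1) \<Omega> ball Lam K V u u0]
      unfolding \<delta>_def I_def \<kappa>_def vol_def C_def n_def T_def .
    also have "\<dots> = ennreal (c1 * \<rho>) + ennreal (c2 * \<rho>) * Y
        + (\<integral>\<^sup>+x\<in>ball x0 (3 * r / 2). ennreal \<bar>pos_part V x\<bar> \<partial>lebesgue)"
      unfolding near[symmetric] far[symmetric] ennreal_mult'[OF k0] by (simp only: distrib_left mult.assoc)
    also have "\<dots> \<le> ennreal (c1 * \<rho>) * Z + ennreal (c2 * \<rho>) * Y + ennreal (c3 * \<rho>) * Z"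
    proof (intro add_mono Vint order_refl)
      \<comment> \<open>The cutoff term carries neither the tail nor the norm; the summand 1 in
        \<open>Z\<close> absorbs it.\<close>
      have "ennreal (c1 * \<rho>) * 1 \<le> ennreal (c1 * \<rho>) * Z" by (intro mult_left_mono) (auto simp: Z_def)
      then show "ennreal (c1 * \<rho>) \<le> ennreal (c1 * \<rho>) * Z" by simp
    qed
    also have "\<dots> \<le> ennreal ((c1 + c2 + c3) * \<rho>) * (Y + Z)"
    proof -
      have "ennreal ((c1 + c2 + c3) * \<rho>) = ennreal (c1 * \<rho>) + ennreal (c2 * \<rho>) + ennreal (c3 * \<rho>)"
        using c rho by (simp add: distrib_right)
      then show ?thesis
        by (simp add: distrib_left distrib_right add_mono add_increasing2 add_increasing ac_simps)
    qed
    finally have le: "ennreal \<delta> * I \<le> ennreal ((c1 + c2 + c3) * \<rho>) * (Y + Z)" .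
    \<comment> \<open>Multiplying by the reciprocal of a positive real is legitimate even if
      \<open>I\<close> is infinite.\<close>
    have "I = ennreal (1 / \<delta>) * (ennreal \<delta> * I)"
      using d0 by (simp add: mult.assoc[symmetric] ennreal_mult[symmetric])
    also have "\<dots> \<le> ennreal (1 / \<delta>) * (ennreal ((c1 + c2 + c3) * \<rho>) * (Y + Z))"
      by (intro mult_left_mono le) simp
    also have "\<dots> = ennreal (c0 * \<rho>) * (Y + Z)"
      using d0 c rho by (simp add: mult.assoc[symmetric] ennreal_mult[symmetric] c0_def)
    finally show "(\<integral>\<^sup>+z\<in>ball x0 r \<times> ball x0 r.
          ennreal (\<bar>ln ((u (fst z) + b) / (u (snd z) + b))\<bar> powr p) \<partial>kernel_measure K)
      \<le> ennreal (c0 * r powr (real CARD('n) - p * s)) *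
          (ennreal (1 / b powr (p - 1) * (r / R) powr (p * s)) *
             epowr (tail s p R (neg_part u) x0) (p - 1)
           + (1 + Lq_norm q \<Omega> (pos_part V)))"
      unfolding I_def \<rho>_def Y_def Z_def n_def .
  qed
qed

end
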